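(* Let $\Omega\subset\mathbb{R}^d$ be a bounded domain with smooth boundary, let $\rho\in C^\infty(\bar\Omega)$ be strictly positive, and let $\omega_0\in C^{0,1}(\bar\Omega)$. Let $(\omega,\phi)$ be the unique global solution of the WLF system with initial datum $\omega_0$ (see context). Then $$\operatorname{osc}\omega(t):=\max_{\bar\Omega}\omega(t,\cdot)-\min_{\bar\Omega}\omega(t,\cdot)=e^{-t}\operatorname{osc}\omega_0$$ for every $t\ge0$.
   Context: WLF system. A global solution with initial datum $\omega_0$ is a pair of functions $\omega,\phi$ on $[0,\infty)\times\bar\Omega$, together with the scalar function $\bar\omega(t)$ and the flow $X(t,x)$ of $\nabla\phi$, such that for all $t\ge0$: (1) $\frac1\rho\nabla\cdot(\rho\nabla\phi)=-(\omega-\bar\omega)$ in $\Omega$; (2) $\frac{d}{dt}\omega(t,X(t,x))=-(\omega(t,X(t,x))-\bar\omega(t))$ for every $x\in\bar\Omega$; (3) $\frac{d}{dt}X(t,x)=\nabla\phi(t,X(t,x))$, $X(0,x)=x$; (4) $\partial\phi/\partial n=0$ on $\partial\Omega$; (5) $\int_\Omega\rho(x)(\omega(t,x)-\bar\omega(t))\,dx=0$ and $\int_\Omega\phi(t,x)\,dx=0$; and $\omega(0,\cdot)=\omega_0$. The solution considered is the unique one with, for every $T<\infty$ and every $\alpha\in(0,1)$, $\omega\in L^\infty([0,T];C^{0,1}(\bar\Omega))\cap C([0,T];C^{0,\alpha}(\bar\Omega))$ and $\phi\in L^\infty([0,T];C^{2,\alpha}(\bar\Omega))\cap C([0,T];C^{2,\alpha}(\bar\Omega))$;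 it exists for every $\omega_0\in C^{0,1}(\bar\Omega)$. *)

theory Defs
  imports "HOL-Analysis.Analysis"
begin

text \<open>Iterated partial derivatives; a list of basis vectors plays the role of a multi-index
  (the last entry is differentiated first).\<close>

fun partials :: "'a::euclidean_space list \<Rightarrow> ('a \<Rightarrow> real) \<Rightarrow> 'a \<Rightarrow> real" where
  "partials [] f = f"
| "partials (b # bs) f = (\<lambda>x. frechet_derivative (partials bs f) (at x) b)"

definition indices_upto :: "nat \<Rightarrow> 'a::euclidean_space list set" where
  "indices_upto k = {bs. set bs \<subseteq> Basis \<and> length bs \<le> k}"

definition indices_eq :: "nat \<Rightarrow> 'a::euclidean_space list set" where
  "indices_eq k = {bs. set bs \<subseteq> Basis \<and> length bs = k}"

text \<open>$C^k(U)$ and $C^\infty(U)$ for open $U$.\<close>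

definition Ck_on :: "nat \<Rightarrow> 'a::euclidean_space set \<Rightarrow> ('a \<Rightarrow> real) \<Rightarrow> bool" where
  "Ck_on k U f \<longleftrightarrow>
     (\<forall>bs\<in>indices_upto k. continuous_on U (partials bs f)) \<and>
     (\<forall>bs\<in>indices_upto k. length bs < k \<longrightarrow> (\<forall>x\<in>U. partials bs f differentiable at x))"

definition smooth_on :: "'a::euclidean_space set \<Rightarrow> ('a \<Rightarrow> real) \<Rightarrow> bool" where
  "smooth_on U f \<longleftrightarrow> (\<forall>k. Ck_on k U f)"

text \<open>Derivatives of a function on the closure of an open set: inside they are the ordinary ones,
  at boundary points they are the limits from inside. Values of the function outside the
  closure are irrelevant.\<close>

definition partials_ext :: "'a::euclidean_space set \<Rightarrow> 'a list \<Rightarrow> ('a \<Rightarrow> real) \<Rightarrow> 'a \<Rightarrow> real" where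
  "partials_ext \<Omega> bs f x =
     (if x \<in> \<Omega> then partials bs f x else Lim (at x within \<Omega>) (partials bs f))"

definition grad :: "'a::euclidean_space set \<Rightarrow> ('a \<Rightarrow> real) \<Rightarrow> 'a \<Rightarrow> 'a" where
  "grad \<Omega> f x = (\<Sum>b\<in>Basis. partials_ext \<Omega> [b] f x *\<^sub>R b)"

definition divergence :: "('a::euclidean_space \<Rightarrow> 'a) \<Rightarrow> 'a \<Rightarrow> real" where
  "divergence F x = (\<Sum>b\<in>Basis. frechet_derivative F (at x) b \<bullet> b)"

text \<open>$C^k(\bar\Omega)$: $C^k$ inside, with all derivatives up to order $k$ extending continuously
  to the closure.\<close>

definition Ck_closure :: "nat \<Rightarrow> 'a::euclidean_space set \<Rightarrow> ('a \<Rightarrow> real) \<Rightarrow> bool" where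
  "Ck_closure k \<Omega> f \<longleftrightarrow>
     Ck_on k \<Omega> f \<and> continuous_on (closure \<Omega>) f \<and>
     (\<forall>bs\<in>indices_upto k. continuous_on (closure \<Omega>) (partials_ext \<Omega> bs f))"

definition smooth_closure :: "'a::euclidean_space set \<Rightarrow> ('a \<Rightarrow> real) \<Rightarrow> bool" where
  "smooth_closure \<Omega> f \<longleftrightarrow> (\<forall>k. Ck_closure k \<Omega> f)"

text \<open>The $C^{k,\alpha}(\bar\Omega)$ norm, possibly infinite. A mixed derivative is counted once for each
  order of differentiation, which gives an equivalent norm; for functions continuous on the closure,
  suprema over the open set equal those over the closure.\<close>

definition holder_norm :: "nat \<Rightarrow> real \<Rightarrow> 'a::euclidean_space set \<Rightarrow> ('a \<Rightarrow> real) \<Rightarrow> ennreal" where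
  "holder_norm k \<alpha> \<Omega> f =
     (\<Sum>bs\<in>indices_upto k. SUP x\<in>\<Omega>. ennreal \<bar>partials bs f x\<bar>) +
     (\<Sum>bs\<in>indices_eq k. SUP (x, y)\<in>{(x, y). x \<in> \<Omega> \<and> y \<in> \<Omega> \<and> x \<noteq> y}.
        ennreal (\<bar>partials bs f x - partials bs f y\<bar> / dist x y powr \<alpha>))"

definition holder_space :: "nat \<Rightarrow> real \<Rightarrow> 'a::euclidean_space set \<Rightarrow> ('a \<Rightarrow> real) set" where
  "holder_space k \<alpha> \<Omega> = {f. Ck_closure k \<Omega> f \<and> holder_norm k \<alpha> \<Omega> f < \<infinity>}"

text \<open>$L^\infty([0,T];C^{k,\alpha}(\bar\Omega))$ (essential boundedness of the norm; measurability in
  time is not imposed separately) and $C([0,T];C^{k,\alpha}(\bar\Omega))$.\<close>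

definition Linf_holder ::
    "real \<Rightarrow> nat \<Rightarrow> real \<Rightarrow> 'a::euclidean_space set \<Rightarrow> (real \<Rightarrow> 'a \<Rightarrow> real) \<Rightarrow> bool" where
  "Linf_holder T k \<alpha> \<Omega> f \<longleftrightarrow>
     (\<exists>M::real. AE t in lborel. t \<in> {0..T} \<longrightarrow>
        f t \<in> holder_space k \<alpha> \<Omega> \<and> holder_norm k \<alpha> \<Omega> (f t) \<le> ennreal M)"

definition C_holder ::
    "real \<Rightarrow> nat \<Rightarrow> real \<Rightarrow> 'a::euclidean_space set \<Rightarrow> (real \<Rightarrow> 'a \<Rightarrow> real) \<Rightarrow> bool" where
  "C_holder T k \<alpha> \<Omega> f \<longleftrightarrow>
     (\<forall>t\<in>{0..T}. f t \<in> holder_space k \<alpha> \<Omega> \<and>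
        ((\<lambda>s. holder_norm k \<alpha> \<Omega> (\<lambda>x. f s x - f t x)) \<longlongrightarrow> 0) (at t within {0..T}))"

text \<open>Smooth boundary: near each boundary point, the set is the negativity set of a smooth function
  with nowhere vanishing gradient, i.e. the set lies locally on one side of the smooth hypersurface
  $\{g = 0\}$. The normalised gradient of such a function is the outward unit normal.\<close>

definition local_defining_function ::
    "'a::euclidean_space set \<Rightarrow> 'a \<Rightarrow> 'a set \<Rightarrow> ('a \<Rightarrow> real) \<Rightarrow> bool" where
  "local_defining_function \<Omega> p U g \<longleftrightarrow>
     open U \<and> p \<in> U \<and> smooth_on U g \<and> (\<forall>x\<in>U. grad U g x \<noteq> 0) \<and>
     \<Omega> \<inter> U = {x \<in> U. g x < 0}"

definition smooth_boundary :: "'a::euclidean_space set \<Rightarrow> bool" where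
  "smooth_boundary \<Omega> \<longleftrightarrow> (\<forall>p\<in>frontier \<Omega>. \<exists>U g. local_defining_function \<Omega> p U g)"

definition outward_unit_normal :: "'a::euclidean_space set \<Rightarrow> 'a \<Rightarrow> 'a \<Rightarrow> bool" where
  "outward_unit_normal \<Omega> p n \<longleftrightarrow> p \<in> frontier \<Omega> \<and>
     (\<exists>U g. local_defining_function \<Omega> p U g \<and> n = grad U g p /\<^sub>R norm (grad U g p))"

definition bounded_smooth_domain :: "'a::euclidean_space set \<Rightarrow> bool" where
  "bounded_smooth_domain \<Omega> \<longleftrightarrow>
     open \<Omega> \<and> connected \<Omega> \<and> \<Omega> \<noteq> {} \<and> bounded \<Omega> \<and> smooth_boundary \<Omega>"

text \<open>The WLF system. Only times $t \ge 0$ and points of the closure matter, so time derivatives at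
  $0$ are one-sided. That the flow stays in the closure is implicit in evaluating $\omega$ and
  $\nabla\phi$ along it.\<close>

definition WLF_system ::
    "'a::euclidean_space set \<Rightarrow> ('a \<Rightarrow> real) \<Rightarrow> ('a \<Rightarrow> real) \<Rightarrow> (real \<Rightarrow> 'a \<Rightarrow> real) \<Rightarrow>
     (real \<Rightarrow> 'a \<Rightarrow> real) \<Rightarrow> (real \<Rightarrow> real) \<Rightarrow> (real \<Rightarrow> 'a \<Rightarrow> 'a) \<Rightarrow> bool" where
  "WLF_system \<Omega> \<rho> \<omega>\<^sub>0 \<omega> \<phi> \<omega>bar X \<longleftrightarrow>
     (\<forall>t\<ge>0. \<forall>x\<in>\<Omega>.
        1 / \<rho> x * divergence (\<lambda>y. \<rho> y *\<^sub>R grad \<Omega> (\<phi> t) y) x = - (\<omega> t x - \<omega>bar t)) \<and>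
     (\<forall>t\<ge>0. \<forall>x\<in>closure \<Omega>. X t x \<in> closure \<Omega>) \<and>
     (\<forall>t\<ge>0. \<forall>x\<in>closure \<Omega>.
        ((\<lambda>s. \<omega> s (X s x)) has_real_derivative - (\<omega> t (X t x) - \<omega>bar t)) (at t within {0..})) \<and>
     (\<forall>t\<ge>0. \<forall>x\<in>closure \<Omega>.
        ((\<lambda>s. X s x) has_vector_derivative grad \<Omega> (\<phi> t) (X t x)) (at t within {0..})) \<and>
     (\<forall>x\<in>closure \<Omega>. X 0 x = x) \<and>
     (\<forall>t\<ge>0. \<forall>x\<in>frontier \<Omega>. \<forall>n. outward_unit_normal \<Omega> x n \<longrightarrow> grad \<Omega> (\<phi> t) x \<bullet> n = 0) \<and>
     (\<forall>t\<ge>0. (LINT x:\<Omega>|lborel. \<rho> x * (\<omega> t x - \<omega>bar t)) = 0 \<and> (LINT x:\<Omega>|lborel. \<phi> t x) = 0) \<and>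
     (\<forall>x\<in>closure \<Omega>. \<omega> 0 x = \<omega>\<^sub>0 x)"

definition WLF_regularity ::
    "'a::euclidean_space set \<Rightarrow> (real \<Rightarrow> 'a \<Rightarrow> real) \<Rightarrow> (real \<Rightarrow> 'a \<Rightarrow> real) \<Rightarrow> bool" where
  "WLF_regularity \<Omega> \<omega> \<phi> \<longleftrightarrow>
     (\<forall>T>0. \<forall>\<alpha>\<in>{0<..<1}.
        Linf_holder T 0 1 \<Omega> \<omega> \<and> C_holder T 0 \<alpha> \<Omega> \<omega> \<and>
        Linf_holder T 2 \<alpha> \<Omega> \<phi> \<and> C_holder T 2 \<alpha> \<Omega> \<phi>)"

definition global_WLF_solution ::
    "'a::euclidean_space set \<Rightarrow> ('a \<Rightarrow> real) \<Rightarrow> ('a \<Rightarrow> real) \<Rightarrow> (real \<Rightarrow> 'a \<Rightarrow> real) \<Rightarrow>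
     (real \<Rightarrow> 'a \<Rightarrow> real) \<Rightarrow> (real \<Rightarrow> real) \<Rightarrow> (real \<Rightarrow> 'a \<Rightarrow> 'a) \<Rightarrow> bool" where
  "global_WLF_solution \<Omega> \<rho> \<omega>\<^sub>0 \<omega> \<phi> \<omega>bar X \<longleftrightarrow>
     WLF_system \<Omega> \<rho> \<omega>\<^sub>0 \<omega> \<phi> \<omega>bar X \<and> WLF_regularity \<Omega> \<omega> \<phi>"

text \<open>Maximum minus minimum; both exist for continuous functions on a nonempty compact set.\<close>

definition osc :: "'a set \<Rightarrow> ('a \<Rightarrow> real) \<Rightarrow> real" where
  "osc S f = (GREATEST y. y \<in> f ` S) - (LEAST y. y \<in> f ` S)"

end

theory Submission
  imports Defs
begin

text \<open>Along two trajectories the term \<open>\<omega>bar\<close> cancels, so the difference of the values of \<open>\<omega>\<close> decays exactly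
  like \<open>exp (- t)\<close>; hence \<open>\<omega> t\<close> composed with \<open>X t\<close> is an affine image of \<open>\<omega>\<^sub>0\<close> with factor \<open>exp (- t)\<close>, and it
  remains to see that \<open>X t\<close> maps the closure of the domain onto itself. No backward flow is
  constructed for this. The velocity \<open>\<nabla>\<phi>\<close> is Lipschitz up to the boundary, so the flow is continuous by
  Gronwall, and by the Neumann condition a second Gronwall argument, for a defining function of the
  boundary, shows that trajectories starting on the boundary stay there. The flow is thus a
  homotopy from the identity to \<open>X t\<close> preserving the boundary. If \<open>X t\<close> missed a point \<open>p\<close> of the domain,
  Borsuk's homotopy extension theorem would extend the radial projection away from \<open>p\<close> from the
  boundary to the whole closure, giving a retraction of a large ball onto its sphere.\<close>

subsection \<open>Topology, Gronwall, oscillation\<close>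

text \<open>If \<open>H T\<close> misses \<open>p\<close>, then \<open>sgn (H T x - p)\<close> is
  continuous on the whole closure. On the frontier it is homotopic in the unit sphere to
  \<open>sgn (x - p)\<close>, because frontier points stay on the frontier and never meet
  \<open>p\<close>. So the radial projection extends over the closure, which the no-retraction
  theorem forbids.\<close>

lemma homotopy_preserving_frontier_image_superset:
  fixes H :: "real \<Rightarrow> 'a::euclidean_space \<Rightarrow> 'a"
  assumes "open \<Omega>" "bounded \<Omega>" "0 \<le> T"
    and cont: "continuous_on ({0..T} \<times> closure \<Omega>) (\<lambda>(t, x). H t x)"
    and H0: "\<And>x. x \<in> closure \<Omega> \<Longrightarrow> H 0 x = x"
    and fr: "\<And>t x. t \<in> {0..T} \<Longrightarrow> x \<in> frontier \<Omega> \<Longrightarrow> H t x \<in> frontier \<Omega>"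
  shows "\<Omega> \<subseteq> H T ` closure \<Omega>"
proof
  fix p assume p: "p \<in> \<Omega>"
  show "p \<in> H T ` closure \<Omega>"
  proof (rule ccontr)
    assume np: "p \<notin> H T ` closure \<Omega>"
    have frc: "frontier \<Omega> \<subseteq> closure \<Omega>" by (simp add: frontier_def)
    have pfr: "p \<notin> frontier \<Omega>" using p \<open>open \<Omega>\<close> by (simp add: frontier_def interior_open)
    have contT: "continuous_on (closure \<Omega>) (\<lambda>x. sgn (H T x - p))"
    proof -
      have "continuous_on (closure \<Omega>) ((\<lambda>(t, x). H t x) \<circ> (\<lambda>x. (T, x)))"
        using \<open>0 \<le> T\<close>
        by (intro continuous_on_compose continuous_intros continuous_on_subset[OF cont]) auto
      then show ?thesis using np by (intro continuous_intros) (auto simp: o_def)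
    qed
    \<comment> \<open>The factor \<open>T\<close> rescales the unit interval of the homotopy to
      \<open>{0..T}\<close>; this also covers \<open>T = 0\<close>.\<close>
    have hom: "homotopic_with_canon (\<lambda>_. True) (frontier \<Omega>) (sphere 0 1)
        (\<lambda>x. sgn (H 0 x - p)) (\<lambda>x. sgn (H T x - p))"
    proof -
      have "continuous_on ({0..1} \<times> frontier \<Omega>)
          ((\<lambda>(t, x). H t x) \<circ> (\<lambda>z::real \<times> 'a. (T * fst z, snd z)))"
        using \<open>0 \<le> T\<close> frc
        by (intro continuous_on_compose continuous_intros continuous_on_subset[OF cont])
          (auto simp: mult_left_le)
      moreover have nz: "H (T * t) x \<noteq> p" if "t \<in> {0..1}" "x \<in> frontier \<Omega>" for t x
        using fr[of "T * t" x] that pfr \<open>0 \<le> T\<close> by (auto simp: mult_left_le)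
      ultimately have c: "continuous_on ({0..1} \<times> frontier \<Omega>) (\<lambda>z. sgn (H (T * fst z) (snd z) - p))"
        by (intro continuous_intros) (auto simp: o_def)
      then show ?thesis
        unfolding homotopic_with_def
        using nz by (intro exI[of _ "\<lambda>z. sgn (H (T * fst z) (snd z) - p)"])
          (auto simp: norm_sgn)
    qed
    have mem: "(\<lambda>x. sgn (H T x - p)) \<in> closure \<Omega> \<rightarrow> sphere 0 1"
      using np by (auto simp: norm_sgn)
    have cl: "closedin (top_of_set (closure \<Omega>)) (frontier \<Omega>)"
      using frc by (simp add: closed_subset)
    \<comment> \<open>The homotopy is used backwards: the map at time \<open>T\<close> is already
      defined on the closure, and the extension property passes this on to the map at time 0, which
      on the frontier is the radial projection.\<close>
    obtain g' where g': "continuous_on (closure \<Omega>) g'" "g' ` closure \<Omega> \<subseteq> sphere 0 1"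
      and g'eq: "\<And>x. x \<in> frontier \<Omega> \<Longrightarrow> g' x = sgn (H 0 x - p)"
    proof (rule Borsuk_homotopy_extension_homotopic[OF cl disjI2[OF ANR_sphere] contT mem
            homotopic_with_symD[OF hom]])
      fix g' assume "continuous_on (closure \<Omega>) g'" "g' ` closure \<Omega> \<subseteq> sphere 0 1"
        "\<And>x. x \<in> frontier \<Omega> \<Longrightarrow> g' x = sgn (H 0 x - p)"
      then show thesis by (rule that)
    qed
    have "bounded (closure \<Omega>)" using \<open>bounded \<Omega>\<close> by (rule bounded_closure)
    then obtain R where R: "R > 0" "closure \<Omega> \<subseteq> ball p R"
      using bounded_subset_ballD by blast
    \<comment> \<open>The two pieces live on the closed sets \<open>- \<Omega>\<close> and
      \<open>closure \<Omega>\<close>. These overlap exactly in the frontier, where both pieces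
      equal \<open>sgn (x - p)\<close>.\<close>
    define q where "q x = (if x \<notin> closure \<Omega> then sgn (x - p) else g' x)" for x
    have "continuous_on (- \<Omega> \<union> closure \<Omega>) q"
      unfolding q_def
    proof (rule continuous_on_cases)
      show "continuous_on (- \<Omega>) (\<lambda>x. sgn (x - p))" using p by (intro continuous_intros) auto
      show "\<forall>x. x \<in> - \<Omega> \<and> \<not> x \<notin> closure \<Omega> \<or> x \<in> closure \<Omega> \<and> x \<notin> closure \<Omega> \<longrightarrow> sgn (x - p) = g' x"
      proof (intro allI impI)
        fix x assume "x \<in> - \<Omega> \<and> \<not> x \<notin> closure \<Omega> \<or> x \<in> closure \<Omega> \<and> x \<notin> closure \<Omega>"
        then have "x \<in> frontier \<Omega>" using \<open>open \<Omega>\<close> by (auto simp: frontier_def interior_open)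
        then show "sgn (x - p) = g' x" using g'eq H0 frc by auto
      qed
    qed (use g' \<open>open \<Omega>\<close> in auto)
    moreover have "- \<Omega> \<union> closure \<Omega> = UNIV" using closure_subset by auto
    ultimately have qc: "continuous_on UNIV q" by simp
    have qn: "norm (q x) = 1" for x
      using g' p closure_subset[of \<Omega>] by (auto simp: q_def norm_sgn)
    \<comment> \<open>The sphere of radius \<open>R\<close> lies outside the closure, where
      \<open>q\<close> is the radial projection; hence the map fixes it.\<close>
    have "retraction (cball p R) (frontier (cball p R)) (\<lambda>x. p + R *\<^sub>R q x)"
      unfolding retraction_def
    proof (intro conjI ballI)
      show "continuous_on (cball p R) (\<lambda>x. p + R *\<^sub>R q x)"
        by (intro continuous_intros continuous_on_subset[OF qc]) auto
      show "(\<lambda>x. p + R *\<^sub>R q x) \<in> cball p R \<rightarrow> frontier (cball p R)"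
        using qn R by (auto simp: dist_norm)
      fix x assume "x \<in> frontier (cball p R)"
      then have x: "norm (x - p) = R" by (simp add: dist_norm norm_minus_commute)
      then have "x \<notin> closure \<Omega>" using R by (auto simp: dist_norm norm_minus_commute)
      then show "p + R *\<^sub>R q x = x" using x R by (simp add: q_def sgn_div_norm)
    qed auto
    then show False using no_retraction_cball[OF \<open>R > 0\<close>] by (auto simp: retract_of_def)
  qed
qed

text \<open>The squared norm replaces the norm, which need not be differentiable where
  \<open>y\<close> vanishes: \<open>exp (- (2 * L * t)) * (y t \<bullet> y t)\<close> is
  nonincreasing. Derivatives are asked for in the open interval only, so that one-sided derivatives
  at time 0 cause no trouble.\<close>

lemma gronwall_norm_le:
  fixes y :: "real \<Rightarrow> 'b::real_inner"
  assumes "a \<le> b" "continuous_on {a..b} y"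
    and der: "\<And>t. a < t \<Longrightarrow> t < b \<Longrightarrow> (y has_vector_derivative y' t) (at t)"
    and le: "\<And>t. a < t \<Longrightarrow> t < b \<Longrightarrow> norm (y' t) \<le> L * norm (y t)"
  shows "norm (y b) \<le> exp (L * (b - a)) * norm (y a)"
proof -
  let ?u = "\<lambda>t. exp (- (2 * L * t)) * (y t \<bullet> y t)"
  have "?u b \<le> ?u a"
  proof (rule DERIV_nonpos_imp_decreasing_open[OF \<open>a \<le> b\<close>])
    fix t assume t: "a < t" "t < b"
    have y: "(y has_derivative (\<lambda>h. h *\<^sub>R y' t)) (at t)"
      using der[OF t] by (simp add: has_vector_derivative_def)
    have "((\<lambda>t. y t \<bullet> y t) has_derivative (\<lambda>h. y t \<bullet> (h *\<^sub>R y' t) + (h *\<^sub>R y' t) \<bullet> y t)) (at t)"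
      by (rule has_derivative_inner[OF y y])
    then have "((\<lambda>t. y t \<bullet> y t) has_real_derivative 2 * (y t \<bullet> y' t)) (at t)"
      unfolding has_field_derivative_def
      by (rule has_derivative_eq_rhs) (auto simp: inner_commute)
    then have "(?u has_real_derivative
        exp (- (2 * L * t)) * (2 * (y t \<bullet> y' t)) + exp (- (2 * L * t)) * (- (2 * L)) * (y t \<bullet> y t)) (at t)"
      by (auto intro!: derivative_eq_intros)
    moreover have "y t \<bullet> y' t \<le> L * (y t \<bullet> y t)"
    proof -
      have "y t \<bullet> y' t \<le> norm (y t) * norm (y' t)" by (rule norm_cauchy_schwarz)
      also have "\<dots> \<le> norm (y t) * (L * norm (y t))"
        using le[OF t] by (intro mult_left_mono) auto
      finally show ?thesis by (simp add: dot_square_norm power2_eq_square mult_ac)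
    qed
    then have "exp (- (2 * L * t)) * (2 * (y t \<bullet> y' t) - 2 * L * (y t \<bullet> y t)) \<le> 0"
      by (intro mult_nonneg_nonpos) auto
    ultimately show "\<exists>d. (?u has_real_derivative d) (at t) \<and> d \<le> 0"
      by (intro exI conjI) (assumption, simp add: algebra_simps)
  qed (use assms(2) in \<open>intro continuous_intros\<close>)
  then have "exp (2 * L * b) * ?u b \<le> exp (2 * L * b) * ?u a" by simp
  moreover have "exp (2 * L * b) * ?u b = (norm (y b))\<^sup>2"
    by (simp add: dot_square_norm exp_minus)
  moreover have "exp (2 * L * b) * exp (- (2 * L * a)) = exp (L * (b - a)) ^ 2"
    unfolding exp_add[symmetric] exp_of_nat_mult[symmetric] by (simp add: algebra_simps)
  then have "exp (2 * L * b) * ?u a = (exp (L * (b - a)) * norm (y a))\<^sup>2"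
    by (simp add: dot_square_norm power_mult_distrib flip: mult.assoc)
  ultimately have "(norm (y b))\<^sup>2 \<le> (exp (L * (b - a)) * norm (y a))\<^sup>2" by simp
  then show ?thesis by (rule power2_le_imp_le) simp
qed

lemma osc_eq:
  assumes "a \<in> S" "b \<in> S" "\<And>x. x \<in> S \<Longrightarrow> f a \<le> f x" "\<And>x. x \<in> S \<Longrightarrow> f x \<le> f b"
  shows "osc S f = f b - f a"
proof -
  have "(GREATEST y. y \<in> f ` S) = f b" using assms by (intro Greatest_equality) auto
  moreover have "(LEAST y. y \<in> f ` S) = f a" using assms by (intro Least_equality) auto
  ultimately show ?thesis by (simp add: osc_def)
qed

text \<open>The extrema of \<open>f\<close> are inherited from \<open>g\<close>: since
  \<open>\<Phi>\<close> is onto and \<open>k\<close> is nonnegative, they sit at the images under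
  \<open>\<Phi>\<close> of the extremal points of \<open>g\<close>.\<close>

lemma osc_affine_reparametrization:
  fixes S :: "'a::topological_space set"
  assumes "compact S" "S \<noteq> {}" "continuous_on S g" "\<Phi> ` S = S" "0 \<le> k"
    and eq: "\<And>x. x \<in> S \<Longrightarrow> f (\<Phi> x) = k * g x + c"
  shows "osc S f = k * osc S g"
proof -
  obtain a where a: "a \<in> S" "\<And>x. x \<in> S \<Longrightarrow> g a \<le> g x"
    using continuous_attains_inf[OF assms(1-3)] by blast
  obtain b where b: "b \<in> S" "\<And>x. x \<in> S \<Longrightarrow> g x \<le> g b"
    using continuous_attains_sup[OF assms(1-3)] by blast
  have 1: "f (\<Phi> a) \<le> f x" "f x \<le> f (\<Phi> b)" if "x \<in> S" for x
  proof -
    have "x \<in> \<Phi> ` S" using that assms(4) by simp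
    then obtain y where y: "y \<in> S" "x = \<Phi> y" by blast
    have "k * g a \<le> k * g y" "k * g y \<le> k * g b"
      using a(2)[OF y(1)] b(2)[OF y(1)] \<open>0 \<le> k\<close> by (simp_all add: mult_left_mono)
    then show "f (\<Phi> a) \<le> f x" "f x \<le> f (\<Phi> b)"
      using eq[OF a(1)] eq[OF b(1)] eq[OF y(1)] y(2) by simp_all
  qed
  have "\<Phi> a \<in> S" "\<Phi> b \<in> S"
    using imageI[OF a(1), of \<Phi>] imageI[OF b(1), of \<Phi>] assms(4) by simp_all
  then have "osc S f = f (\<Phi> b) - f (\<Phi> a)"
    using 1 by (intro osc_eq)
  also have "\<dots> = k * (g b - g a)"
    using eq[OF a(1)] eq[OF b(1)] by (simp add: algebra_simps)
  also have "g b - g a = osc S g" using a b by (intro osc_eq[symmetric])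
  finally show ?thesis .
qed

text \<open>A mean value inequality whose endpoints may lie on the boundary of the domain, where
  only continuity is available.\<close>

lemma open_segment_derivative_bound:
  fixes f :: "'a::euclidean_space \<Rightarrow> 'b::real_inner"
  assumes "continuous_on (closed_segment x y) f"
    and "\<And>z. z \<in> open_segment x y \<Longrightarrow> (f has_derivative f' z) (at z)"
    and "\<And>z h. z \<in> open_segment x y \<Longrightarrow> norm (f' z h) \<le> M * norm h"
  shows "norm (f x - f y) \<le> M * norm (x - y)"
proof (cases "x = y")
  case False
  let ?l = "\<lambda>s::real. x + s *\<^sub>R (y - x)"
  have "?l ` {0..1} = closed_segment x y"
    by (auto simp: closed_segment_def image_def algebra_simps)
  then have "continuous_on {0..1} (f \<circ> ?l)"
    by (intro continuous_on_compose continuous_intros) (use assms(1) in simp)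
  moreover have os: "?l s \<in> open_segment x y" if "0 < s" "s < 1" for s
    using that False by (auto simp: in_segment algebra_simps)
  have "((f \<circ> ?l) has_derivative (\<lambda>h. f' (?l s) (h *\<^sub>R (y - x)))) (at s)" if "0 < s" "s < 1" for s
  proof -
    have "(?l has_derivative (\<lambda>h. h *\<^sub>R (y - x))) (at s)"
      by (auto intro!: derivative_eq_intros)
    from diff_chain_at[OF this assms(2)[OF os[OF that]]] show ?thesis by (simp add: o_def)
  qed
  ultimately obtain s where "s \<in> {0<..<1}" "norm ((f \<circ> ?l) 1 - (f \<circ> ?l) 0) \<le> norm (f' (?l s) ((1 - 0) *\<^sub>R (y - x)))"
    using mvt_general[of 0 1 "f \<circ> ?l" "\<lambda>s h. f' (?l s) (h *\<^sub>R (y - x))"] by auto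
  then show ?thesis
    using assms(3)[OF os, of s "y - x"] by (auto simp: norm_minus_commute)
qed simp

subsection \<open>Geometry of smooth boundaries\<close>

lemma grad_eq_frechet_derivative:
  "x \<in> U \<Longrightarrow> grad U f x = (\<Sum>b\<in>Basis. frechet_derivative f (at x) b *\<^sub>R b)"
  by (simp add: grad_def partials_ext_def)

lemma has_derivative_grad:
  assumes "f differentiable at x" "x \<in> U"
  shows "(f has_derivative (\<lambda>h. grad U f x \<bullet> h)) (at x)"
proof -
  have D: "(f has_derivative frechet_derivative f (at x)) (at x)"
    using assms(1) frechet_derivative_works by blast
  then have "linear (frechet_derivative f (at x))" by (rule has_derivative_linear)
  have "frechet_derivative f (at x) h = grad U f x \<bullet> h" for h
  proof -
    have "frechet_derivative f (at x) h = frechet_derivative f (at x) (\<Sum>b\<in>Basis. (h \<bullet> b) *\<^sub>R b)"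
      by (simp add: euclidean_representation)
    also have "\<dots> = (\<Sum>b\<in>Basis. (h \<bullet> b) * frechet_derivative f (at x) b)"
      using \<open>linear _\<close> by (simp add: linear_sum linear_scale)
    also have "\<dots> = grad U f x \<bullet> h"
      by (simp add: grad_eq_frechet_derivative[OF assms(2)] inner_sum_left inner_commute[of h] mult.commute)
    finally show ?thesis .
  qed
  then show ?thesis using has_derivative_eq_rhs[OF D] by blast
qed

lemma Ck_on_grad:
  assumes "Ck_on k U f" "1 \<le> k"
  shows "continuous_on U (grad U f)"
    and "\<And>x. x \<in> U \<Longrightarrow> (f has_derivative (\<lambda>h. grad U f x \<bullet> h)) (at x)"
proof -
  have "continuous_on U (partials [b] f)" if "b \<in> Basis" for b
    using assms that by (simp add: Ck_on_def indices_upto_def del: partials.simps)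
  then have "continuous_on U (\<lambda>x. \<Sum>b\<in>Basis. frechet_derivative f (at x) b *\<^sub>R b)"
    by (intro continuous_intros) simp
  then show "continuous_on U (grad U f)"
    by (rule continuous_on_eq) (simp add: grad_eq_frechet_derivative)
  have "[] \<in> indices_upto k" by (simp add: indices_upto_def)
  then have "partials [] f differentiable at x" if "x \<in> U" for x
    using assms that unfolding Ck_on_def by fastforce
  then show "(f has_derivative (\<lambda>h. grad U f x \<bullet> h)) (at x)" if "x \<in> U" for x
    using that by (intro has_derivative_grad) simp
qed

text \<open>The derivative is the Hessian, with entries \<open>partials [c, b] f x\<close>. Each of
  its entries contributes at most \<open>N * norm h\<close>, and adding up all of them gives the
  factor, the square of the dimension.\<close>

lemma grad_derivative_bound:
  fixes f :: "'a::euclidean_space \<Rightarrow> real"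
  assumes C2: "Ck_on 2 U f" and "open U" "x \<in> U"
    and N: "\<And>bs. bs \<in> indices_upto 2 \<Longrightarrow> \<bar>partials bs f x\<bar> \<le> N"
  obtains D where "(grad U f has_derivative D) (at x)"
    and "\<And>h. norm (D h) \<le> (real DIM('a))\<^sup>2 * N * norm h"
proof -
  let ?P = "\<lambda>b. frechet_derivative (partials [b] f) (at x)"
  have d: "(partials [b] f has_derivative ?P b) (at x)" if "b \<in> Basis" for b
  proof -
    have "[b] \<in> indices_upto 2" using that by (simp add: indices_upto_def)
    then have "partials [b] f differentiable at x"
      using C2 \<open>x \<in> U\<close> unfolding Ck_on_def by fastforce
    then show ?thesis using frechet_derivative_works by blast
  qed
  have "((\<lambda>y. \<Sum>b\<in>Basis. partials [b] f y *\<^sub>R b) has_derivative (\<lambda>h. \<Sum>b\<in>Basis. ?P b h *\<^sub>R b)) (at x)"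
    using d by (intro has_derivative_sum has_derivative_scaleR_left)
  then have "(grad U f has_derivative (\<lambda>h. \<Sum>b\<in>Basis. ?P b h *\<^sub>R b)) (at x)"
    by (rule has_derivative_transform_within_open[OF _ \<open>open U\<close> \<open>x \<in> U\<close>])
      (simp add: grad_eq_frechet_derivative)
  moreover have "norm (\<Sum>b\<in>Basis. ?P b h *\<^sub>R b) \<le> (real DIM('a))\<^sup>2 * N * norm h" for h
  proof -
    have "\<bar>?P b h\<bar> \<le> real DIM('a) * (N * norm h)" if b: "b \<in> Basis" for b
    proof -
      have "linear (?P b)" using d[OF b] by (rule has_derivative_linear)
      then have "?P b (\<Sum>c\<in>Basis. (h \<bullet> c) *\<^sub>R c) = (\<Sum>c\<in>Basis. (h \<bullet> c) * partials [c, b] f x)"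
        by (simp add: linear_sum linear_scale)
      then have P: "?P b h = (\<Sum>c\<in>Basis. (h \<bullet> c) * partials [c, b] f x)"
        by (simp add: euclidean_representation)
      have "\<bar>(h \<bullet> c) * partials [c, b] f x\<bar> \<le> N * norm h" if c: "c \<in> Basis" for c
      proof -
        have "\<bar>partials [c, b] f x\<bar> \<le> N" using b c by (intro N) (simp add: indices_upto_def)
        moreover have "\<bar>h \<bullet> c\<bar> \<le> norm h" using Basis_le_norm[OF c] .
        ultimately show ?thesis
          by (simp add: abs_mult mult.commute[of N] mult_mono)
      qed
      then have "norm (\<Sum>c\<in>(Basis::'a set). (h \<bullet> c) * partials [c, b] f x) \<le> (\<Sum>c\<in>(Basis::'a set). N * norm h)"
        by (intro sum_norm_le) simp
      then show ?thesis unfolding P by simp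
    qed
    then have "norm (\<Sum>b\<in>Basis. ?P b h *\<^sub>R b) \<le> (\<Sum>b\<in>(Basis::'a set). real DIM('a) * (N * norm h))"
      by (intro sum_norm_le) simp
    then show ?thesis by (simp add: power2_eq_square mult_ac)
  qed
  ultimately show ?thesis by (rule that)
qed

lemma grad_norm_bound:
  fixes f :: "'a::euclidean_space \<Rightarrow> real"
  assumes "x \<in> U" and N: "\<And>bs. bs \<in> indices_upto 2 \<Longrightarrow> \<bar>partials bs f x\<bar> \<le> N"
  shows "norm (grad U f x) \<le> real DIM('a) * N"
proof -
  have "\<bar>frechet_derivative f (at x) b\<bar> \<le> N" if "b \<in> Basis" for b
    using N[of "[b]"] that by (simp add: indices_upto_def)
  then show ?thesis
    unfolding grad_eq_frechet_derivative[OF assms(1)]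
    by (intro order_trans[OF sum_norm_le[of _ _ "\<lambda>_. N"]]) simp_all
qed

text \<open>Here \<open>e\<close> is the unit gradient at \<open>p\<close> and \<open>c\<close> is a
  quarter of the gradient norm \<open>m\<close> there. Moving by \<open>s *\<^sub>R e\<close> raises
  \<open>g\<close> by \<open>m * s\<close> to first order. The deviation from \<open>e\<close> costs
  at most \<open>m * s / 4\<close> and the variation of the gradient at most
  \<open>m / 4 * (5 / 4 * s)\<close>, which leaves \<open>7 / 16 * m * s\<close>.\<close>

lemma local_defining_function_cone:
  fixes p :: "'a::euclidean_space"
  assumes "local_defining_function \<Omega> p U g"
  obtains r c e where "0 < r" "0 < c" "norm e = 1" "ball p r \<subseteq> U"
    and "\<And>a b s. a \<in> ball p r \<Longrightarrow> b \<in> ball p r \<Longrightarrow> norm (b - a - s *\<^sub>R e) \<le> s / 4 \<Longrightarrow> c * s \<le> g b - g a"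
proof -
  have U: "open U" "p \<in> U" and C: "Ck_on 1 U g" and G0: "grad U g p \<noteq> 0"
    using assms by (auto simp: local_defining_function_def smooth_on_def)
  let ?G = "grad U g" and ?m = "norm (grad U g p)"
  define e where "e = ?G p /\<^sub>R ?m"
  have m: "?m > 0" using G0 by simp
  have Ge: "?G p \<bullet> e = ?m" "norm e = 1"
    using G0 by (simp_all add: e_def dot_square_norm power2_eq_square)
  have "continuous (at p) ?G"
    using Ck_on_grad(1)[OF C] U by (simp add: continuous_on_eq_continuous_at)
  then obtain r1 where r1: "r1 > 0" "\<And>x. dist x p < r1 \<Longrightarrow> dist (?G x) (?G p) < ?m / 4"
    using m unfolding continuous_at_eps_delta dist_norm[symmetric] by (meson divide_pos_pos zero_less_numeral)
  obtain r2 where r2: "r2 > 0" "ball p r2 \<subseteq> U" using U openE by blast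
  define r where "r = min r1 r2"
  have *: "norm (?G x - ?G p) \<le> ?m / 4" if "x \<in> ball p r" for x
    using r1(2)[of x] that by (simp add: r_def dist_norm norm_minus_commute)
  have rU: "ball p r \<subseteq> U" using r2(2) by (auto simp: r_def)
  show ?thesis
  proof (rule that[of r "?m / 4" e])
    fix a b s assume ab: "a \<in> ball p r" "b \<in> ball p r" and s: "norm (b - a - s *\<^sub>R e) \<le> s / 4"
    \<comment> \<open>Without its linear part at \<open>p\<close>, \<open>g\<close> has gradient of
      norm at most \<open>m / 4\<close> on the convex ball, so the mean value inequality bounds the
      error of the linearization.\<close>
    let ?k = "\<lambda>x. g x - ?G p \<bullet> x"
    have "norm (?k b - ?k a) \<le> ?m / 4 * norm (b - a)"
    proof (rule differentiable_bound[OF convex_ball _ _ ab(2,1)])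
      fix x assume x: "x \<in> ball p r"
      then have "(g has_derivative (\<lambda>h. ?G x \<bullet> h)) (at x)"
        using Ck_on_grad(2)[OF C] rU by auto
      then have "(?k has_derivative (\<lambda>h. ?G x \<bullet> h - ?G p \<bullet> h)) (at x within ball p r)"
        by (rule has_derivative_diff[OF has_derivative_at_withinI
              has_derivative_inner_right[OF has_derivative_ident]])
      then show "(?k has_derivative (\<lambda>h. (?G x - ?G p) \<bullet> h)) (at x within ball p r)"
        by (simp add: inner_diff_left)
      have "norm ((?G x - ?G p) \<bullet> h) \<le> ?m / 4 * norm h" for h
        using Cauchy_Schwarz_ineq2[of "?G x - ?G p" h] mult_right_mono[OF *[OF x], of "norm h"]
        by simp
      then show "onorm (\<lambda>h. (?G x - ?G p) \<bullet> h) \<le> ?m / 4" by (rule onorm_le)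
    qed
    then have 1: "g b - g a \<ge> ?G p \<bullet> (b - a) - ?m / 4 * norm (b - a)"
      unfolding inner_diff_right real_norm_def by linarith
    define u where "u = b - a - s *\<^sub>R e"
    have ba: "b - a = s *\<^sub>R e + u" and u: "norm u \<le> s / 4" using s by (simp_all add: u_def)
    have s0: "0 \<le> s" using u norm_ge_zero[of u] by linarith
    have "?m * norm u \<le> ?m * (s / 4)" using u by (intro mult_left_mono) auto
    moreover have "\<bar>?G p \<bullet> u\<bar> \<le> ?m * norm u" by (rule Cauchy_Schwarz_ineq2)
    moreover have "?G p \<bullet> (b - a) = s * ?m + ?G p \<bullet> u"
      unfolding ba by (simp add: inner_add_right Ge)
    ultimately have 2: "?G p \<bullet> (b - a) \<ge> ?m * (3 / 4 * s)" by (simp add: algebra_simps abs_le_iff)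
    have "norm (b - a) \<le> norm (s *\<^sub>R e) + norm u" unfolding ba by (rule norm_triangle_ineq)
    also have "\<dots> \<le> 5 / 4 * s" using u s0 Ge by simp
    finally have "?m / 4 * norm (b - a) \<le> ?m / 4 * (5 / 4 * s)" by (intro mult_left_mono) auto
    moreover have "0 \<le> ?m * s" using s0 by simp
    ultimately show "?m / 4 * s \<le> g b - g a" using 1 2 by (simp add: algebra_simps)
  qed (use r1 r2 m Ge rU in \<open>auto simp: r_def\<close>)
qed

text \<open>The part of \<open>U\<close> where \<open>g\<close> is positive is open and misses
  \<open>\<Omega>\<close>, hence it misses the closure too.\<close>

lemma local_defining_function_nonpos_on_closure:
  assumes "local_defining_function \<Omega> p U g" "x \<in> closure \<Omega>" "x \<in> U"
  shows "g x \<le> 0"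
proof (rule ccontr)
  assume "\<not> g x \<le> 0"
  have C: "Ck_on 1 U g" and "open U" and \<Omega>U: "\<Omega> \<inter> U = {x \<in> U. g x < 0}"
    using assms by (auto simp: local_defining_function_def smooth_on_def)
  have "continuous_on U (partials [] g)"
    using C by (simp add: Ck_on_def indices_upto_def del: partials.simps)
  then have "continuous_on U g" by simp
  then have "open (g -` {0<..} \<inter> U)"
    using \<open>open U\<close> by (simp add: continuous_on_open_vimage)
  moreover have "(g -` {0<..} \<inter> U) \<inter> \<Omega> = {}"
  proof -
    have "g z < 0" if "z \<in> \<Omega>" "z \<in> U" for z using \<Omega>U that by blast
    then show ?thesis by force
  qed
  ultimately have "(g -` {0<..} \<inter> U) \<inter> closure \<Omega> = {}"
    by (simp add: open_Int_closure_eq_empty)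
  moreover have "x \<in> (g -` {0<..} \<inter> U) \<inter> closure \<Omega>" using assms \<open>\<not> g x \<le> 0\<close> by simp
  ultimately show False by blast
qed

text \<open>At a boundary point \<open>p\<close> the connecting path pushes both points along the inward normal at \<open>p\<close>,
  by a distance proportional to their separation.\<close>

lemma smooth_boundary_local_connection:
  fixes p :: "'a::euclidean_space"
  assumes "open \<Omega>" "smooth_boundary \<Omega>" "p \<in> closure \<Omega>"
  obtains r where "0 < r"
    and "\<And>x y. x \<in> closure \<Omega> \<inter> cball p r \<Longrightarrow> y \<in> closure \<Omega> \<inter> cball p r \<Longrightarrow> x \<noteq> y \<Longrightarrow>
      \<exists>x' y'. norm (x - x') \<le> 4 * norm (x - y) \<and> norm (x' - y') \<le> norm (x - y) \<and>
        norm (y' - y) \<le> 4 * norm (x - y) \<and>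
        open_segment x x' \<subseteq> \<Omega> \<and> closed_segment x' y' \<subseteq> \<Omega> \<and> open_segment y' y \<subseteq> \<Omega>"
proof (cases "p \<in> \<Omega>")
  case True
  then obtain r where r: "r > 0" "cball p r \<subseteq> \<Omega>"
    using \<open>open \<Omega>\<close> open_contains_cball by blast
  show ?thesis
  proof (rule that[OF r(1)])
    fix x y assume "x \<in> closure \<Omega> \<inter> cball p r" "y \<in> closure \<Omega> \<inter> cball p r"
    then have "closed_segment x y \<subseteq> \<Omega>"
      using r(2) closed_segment_subset[OF _ _ convex_cball] by blast
    then show "\<exists>x' y'. norm (x - x') \<le> 4 * norm (x - y) \<and> norm (x' - y') \<le> norm (x - y) \<and>
        norm (y' - y) \<le> 4 * norm (x - y) \<and>
        open_segment x x' \<subseteq> \<Omega> \<and> closed_segment x' y' \<subseteq> \<Omega> \<and> open_segment y' y \<subseteq> \<Omega>"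
      by (intro exI[of _ x] exI[of _ y]) simp
  qed
next
  case False
  then have "p \<in> frontier \<Omega>" using assms by (simp add: frontier_def interior_open)
  then obtain U g where L: "local_defining_function \<Omega> p U g"
    using assms(2) by (auto simp: smooth_boundary_def)
  then have \<Omega>U: "\<Omega> \<inter> U = {x \<in> U. g x < 0}" by (simp add: local_defining_function_def)
  obtain r c e where r: "0 < r" "0 < c" "norm e = 1" "ball p r \<subseteq> U"
    and cone: "\<And>a b s. a \<in> ball p r \<Longrightarrow> b \<in> ball p r \<Longrightarrow> norm (b - a - s *\<^sub>R e) \<le> s / 4 \<Longrightarrow> c * s \<le> g b - g a"
    by (rule local_defining_function_cone[OF L]) blast
  \<comment> \<open>Descending from \<open>x\<close> against the cone strictly lowers
    \<open>g\<close>, which is nonpositive at \<open>x\<close>. The radii fit because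
    \<open>r / 12 + 5 / 4 * (2 * r / 3) = 11 / 12 * r\<close>.\<close>
  have inner: "x - s *\<^sub>R e + u \<in> \<Omega>"
    if "x \<in> closure \<Omega>" "dist p x \<le> r / 12" "0 < s" "s \<le> 2 * r / 3" "norm u \<le> s / 4" for x s u
  proof -
    let ?z = "x - s *\<^sub>R e + u"
    have "dist p ?z \<le> dist p x + norm (s *\<^sub>R e - u)"
      by (rule order_trans[OF dist_triangle[of _ _ x]]) (simp add: dist_norm algebra_simps)
    also have "norm (s *\<^sub>R e - u) \<le> norm (s *\<^sub>R e) + norm u" by (rule norm_triangle_ineq4)
    finally have z: "?z \<in> ball p r" using that r by simp
    have x: "x \<in> ball p r" using that r by simp
    have "c * s \<le> g x - g ?z" using that by (intro cone[OF z x]) (simp add: algebra_simps)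
    moreover have "g x \<le> 0"
      using local_defining_function_nonpos_on_closure[OF L \<open>x \<in> closure \<Omega>\<close>] x r(4) by auto
    moreover have "0 < c * s" using r(2) \<open>0 < s\<close> by simp
    ultimately have "g ?z < 0" by linarith
    then show ?thesis using z r(4) \<Omega>U by auto
  qed
  show ?thesis
  proof (rule that[of "r / 12"])
    fix x y assume x: "x \<in> closure \<Omega> \<inter> cball p (r / 12)" and y: "y \<in> closure \<Omega> \<inter> cball p (r / 12)"
      and "x \<noteq> y"
    \<comment> \<open>With this push, the separation of the two points equals the tolerance
      \<open>s / 4\<close> of the cone, so the segment between the pushed points stays inside.
      Points within \<open>r / 12\<close> of \<open>p\<close> are at most \<open>r / 6\<close>
      apart, whence \<open>s \<le> 2 * r / 3\<close>.\<close>
    define s where "s = 4 * norm (x - y)"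
    have s: "0 < s" "s \<le> 2 * r / 3"
    proof -
      show "0 < s" using \<open>x \<noteq> y\<close> by (simp add: s_def)
      show "s \<le> 2 * r / 3" using x y dist_triangle2[of x y p] by (simp add: s_def dist_commute dist_norm[symmetric])
    qed
    have seg: "open_segment z (z - s *\<^sub>R e) \<subseteq> \<Omega>" if z: "z \<in> closure \<Omega> \<inter> cball p (r / 12)" for z
    proof
      fix w assume "w \<in> open_segment z (z - s *\<^sub>R e)"
      then obtain \<tau> where \<tau>: "0 < \<tau>" "\<tau> < 1" "w = (1 - \<tau>) *\<^sub>R z + \<tau> *\<^sub>R (z - s *\<^sub>R e)"
        by (auto simp: in_segment)
      have "\<tau> * s \<le> s" using \<tau> s by simp
      then have "\<tau> * s \<le> 2 * r / 3" using s by linarith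
      then have "z - (\<tau> * s) *\<^sub>R e + 0 \<in> \<Omega>" using z \<tau> s by (intro inner) auto
      then show "w \<in> \<Omega>" unfolding \<tau>(3) by (simp add: algebra_simps)
    qed
    have "closed_segment (x - s *\<^sub>R e) (y - s *\<^sub>R e) \<subseteq> \<Omega>"
    proof
      fix w assume "w \<in> closed_segment (x - s *\<^sub>R e) (y - s *\<^sub>R e)"
      then obtain \<tau> where \<tau>: "0 \<le> \<tau>" "\<tau> \<le> 1" "w = (1 - \<tau>) *\<^sub>R (x - s *\<^sub>R e) + \<tau> *\<^sub>R (y - s *\<^sub>R e)"
        by (auto simp: in_segment)
      have "norm (\<tau> *\<^sub>R (y - x)) \<le> s / 4"
        using \<tau> by (simp add: s_def norm_minus_commute mult_left_le_one_le)
      then have "x - s *\<^sub>R e + \<tau> *\<^sub>R (y - x) \<in> \<Omega>" using x s by (intro inner) auto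
      then show "w \<in> \<Omega>" unfolding \<tau>(3) by (simp add: algebra_simps)
    qed
    moreover have "open_segment (y - s *\<^sub>R e) y \<subseteq> \<Omega>" using seg[OF y] by (simp add: open_segment_commute)
    ultimately show "\<exists>x' y'. norm (x - x') \<le> 4 * norm (x - y) \<and> norm (x' - y') \<le> norm (x - y) \<and>
        norm (y' - y) \<le> 4 * norm (x - y) \<and>
        open_segment x x' \<subseteq> \<Omega> \<and> closed_segment x' y' \<subseteq> \<Omega> \<and> open_segment y' y \<subseteq> \<Omega>"
      using seg[OF x] r(3)
      by (intro exI[of _ "x - s *\<^sub>R e"] exI[of _ "y - s *\<^sub>R e"]) (simp add: s_def)
  qed (use r in simp)
qed

lemma closed_segment_subset_closure:
  fixes x :: "'a::euclidean_space"
  assumes "open_segment x y \<subseteq> S" "x \<in> closure S"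
  shows "closed_segment x y \<subseteq> closure S"
proof (cases "x = y")
  case False
  then show ?thesis using closure_mono[OF assms(1)] by (simp add: closure_open_segment)
qed (use assms in simp)

text \<open>The connecting path has length at most 4 + 1 + 4 = 9 times the separation. The radius
  depends on neither \<open>f\<close> nor \<open>M\<close>, so that one radius serves the velocity
  fields of all nearby times.\<close>

lemma smooth_boundary_local_lipschitz:
  fixes p :: "'a::euclidean_space"
  assumes "open \<Omega>" "smooth_boundary \<Omega>" "p \<in> closure \<Omega>"
  obtains r where "0 < r"
    and "\<And>(f :: 'a \<Rightarrow> 'a) M x y. continuous_on (closure \<Omega>) f \<Longrightarrow>
      (\<And>z. z \<in> \<Omega> \<Longrightarrow> \<exists>D. (f has_derivative D) (at z) \<and> (\<forall>h. norm (D h) \<le> M * norm h)) \<Longrightarrow> 0 \<le> M \<Longrightarrow>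
      x \<in> closure \<Omega> \<inter> cball p r \<Longrightarrow> y \<in> closure \<Omega> \<inter> cball p r \<Longrightarrow>
      norm (f x - f y) \<le> 9 * M * norm (x - y)"
proof -
  obtain r where r: "r > 0"
    and conn: "\<And>x y. x \<in> closure \<Omega> \<inter> cball p r \<Longrightarrow> y \<in> closure \<Omega> \<inter> cball p r \<Longrightarrow> x \<noteq> y \<Longrightarrow>
      \<exists>x' y'. norm (x - x') \<le> 4 * norm (x - y) \<and> norm (x' - y') \<le> norm (x - y) \<and>
        norm (y' - y) \<le> 4 * norm (x - y) \<and>
        open_segment x x' \<subseteq> \<Omega> \<and> closed_segment x' y' \<subseteq> \<Omega> \<and> open_segment y' y \<subseteq> \<Omega>"
    by (rule smooth_boundary_local_connection[OF assms]) blast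
  show ?thesis
  proof (rule that[OF r])
    fix f :: "'a \<Rightarrow> 'a" and M x y
    assume cont: "continuous_on (closure \<Omega>) f"
      and der: "\<And>z. z \<in> \<Omega> \<Longrightarrow> \<exists>D. (f has_derivative D) (at z) \<and> (\<forall>h. norm (D h) \<le> M * norm h)"
      and M: "0 \<le> M"
      and x: "x \<in> closure \<Omega> \<inter> cball p r" and y: "y \<in> closure \<Omega> \<inter> cball p r"
    show "norm (f x - f y) \<le> 9 * M * norm (x - y)"
    proof (cases "x = y")
      case False
      from conn[OF x y this] obtain x' y' where
        n: "norm (x - x') \<le> 4 * norm (x - y)" "norm (x' - y') \<le> norm (x - y)"
          "norm (y' - y) \<le> 4 * norm (x - y)"
        and s: "open_segment x x' \<subseteq> \<Omega>" "closed_segment x' y' \<subseteq> \<Omega>" "open_segment y' y \<subseteq> \<Omega>"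
        by blast
      obtain D where D: "\<And>z. z \<in> \<Omega> \<Longrightarrow> (f has_derivative D z) (at z)"
        "\<And>z h. z \<in> \<Omega> \<Longrightarrow> norm (D z h) \<le> M * norm h"
        using der by metis
      have step: "norm (f a - f b) \<le> M * norm (a - b)"
        if "open_segment a b \<subseteq> \<Omega>" "a \<in> closure \<Omega>" for a b
        using that D closed_segment_subset_closure[OF that]
        by (intro open_segment_derivative_bound[of _ _ _ D] continuous_on_subset[OF cont]) auto
      have xy': "x' \<in> \<Omega>" "y' \<in> \<Omega>" "open_segment x' y' \<subseteq> \<Omega>"
        using s(2) by (auto simp: open_segment_def)
      then have cl: "x' \<in> closure \<Omega>" "y' \<in> closure \<Omega>" using closure_subset by auto
      have "norm (f x - f y) \<le> norm (f x - f x') + norm (f x' - f y') + norm (f y' - f y)"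
        by norm
      also have "\<dots> \<le> M * norm (x - x') + M * norm (x' - y') + M * norm (y' - y)"
        using s x cl xy' by (intro add_mono step) auto
      also have "\<dots> \<le> M * (4 * norm (x - y)) + M * norm (x - y) + M * (4 * norm (x - y))"
        using n M by (intro add_mono mult_left_mono) auto
      finally show ?thesis by simp
    qed simp
  qed
qed

subsection \<open>Regularity of the velocity field\<close>

lemma finite_indices_upto: "finite (indices_upto k :: 'a::euclidean_space list set)"
  unfolding indices_upto_def by (rule finite_lists_length_le) simp

text \<open>Continuity in time controls the norm of a difference of functions; this turns it into
  control of the difference of their derivatives.\<close>

lemma partials_diff:
  assumes "open \<Omega>" "Ck_on k \<Omega> f" "Ck_on k \<Omega> g"
  shows "bs \<in> indices_upto k \<Longrightarrow> x \<in> \<Omega> \<Longrightarrow>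
    partials bs (\<lambda>x. f x - g x) x = partials bs f x - partials bs g x"
proof (induction bs arbitrary: x)
  case (Cons b bs)
  then have bs: "bs \<in> indices_upto k" "length bs < k" by (auto simp: indices_upto_def)
  let ?F = "partials bs f" and ?G = "partials bs g"
  have "?F differentiable at x" "?G differentiable at x"
    using assms(2,3) bs Cons.prems(2) unfolding Ck_on_def by blast+
  then have d: "((\<lambda>y. ?F y - ?G y) has_derivative
      (\<lambda>h. frechet_derivative ?F (at x) h - frechet_derivative ?G (at x) h)) (at x)"
    by (intro has_derivative_diff) (simp_all add: frechet_derivative_works)
  have "(partials bs (\<lambda>x. f x - g x) has_derivative
      (\<lambda>h. frechet_derivative ?F (at x) h - frechet_derivative ?G (at x) h)) (at x)"
    by (rule has_derivative_transform_within_open[OF d assms(1) Cons.prems(2)]) (simp add: Cons.IH[OF bs(1)])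
  from frechet_derivative_at[OF this, symmetric] show ?case by simp
qed simp

lemma holder_norm_ge_partials:
  fixes f :: "'a::euclidean_space \<Rightarrow> real"
  assumes "bs \<in> indices_upto k" "x \<in> \<Omega>"
  shows "ennreal \<bar>partials bs f x\<bar> \<le> holder_norm k \<alpha> \<Omega> f"
proof -
  have "ennreal \<bar>partials bs f x\<bar> \<le> (SUP x\<in>\<Omega>. ennreal \<bar>partials bs f x\<bar>)"
    using assms(2) by (rule SUP_upper)
  also have "\<dots> \<le> (\<Sum>bs\<in>indices_upto k. SUP x\<in>\<Omega>. ennreal \<bar>partials bs f x\<bar>)"
    using assms(1) finite_indices_upto by (intro member_le_sum) auto
  also have "\<dots> \<le> holder_norm k \<alpha> \<Omega> f"
    unfolding holder_norm_def by simp
  finally show ?thesis .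
qed

lemma holder_space_partials_bounded:
  fixes f :: "'a::euclidean_space \<Rightarrow> real"
  assumes "f \<in> holder_space k \<alpha> \<Omega>"
  obtains N where "0 \<le> N" "\<And>bs x. bs \<in> indices_upto k \<Longrightarrow> x \<in> \<Omega> \<Longrightarrow> \<bar>partials bs f x\<bar> \<le> N"
proof (rule that)
  fix bs :: "'a list" and x assume "bs \<in> indices_upto k" "x \<in> \<Omega>"
  then have "ennreal \<bar>partials bs f x\<bar> \<le> holder_norm k \<alpha> \<Omega> f" by (rule holder_norm_ge_partials)
  moreover have "holder_norm k \<alpha> \<Omega> f < top" using assms by (simp add: holder_space_def infinity_ennreal_def)
  ultimately show "\<bar>partials bs f x\<bar> \<le> enn2real (holder_norm k \<alpha> \<Omega> f)"
    using enn2real_mono by fastforce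
qed simp

lemma holder_space_Ck_on: "f \<in> holder_space k \<alpha> \<Omega> \<Longrightarrow> Ck_on k \<Omega> f"
  and holder_space_continuous_on: "f \<in> holder_space k \<alpha> \<Omega> \<Longrightarrow> continuous_on (closure \<Omega>) f"
  by (simp_all add: holder_space_def Ck_closure_def)

lemma C_holder_partials_eventually_close:
  fixes f :: "real \<Rightarrow> 'a::euclidean_space \<Rightarrow> real"
  assumes "C_holder T k \<alpha> \<Omega> f" "open \<Omega>" "t \<in> {0..T}" "0 < \<epsilon>"
  shows "\<forall>\<^sub>F s in at t within {0..T}.
    \<forall>bs\<in>indices_upto k. \<forall>x\<in>\<Omega>. \<bar>partials bs (f s) x - partials bs (f t) x\<bar> \<le> \<epsilon>"
proof -
  have C: "f s \<in> holder_space k \<alpha> \<Omega>" if "s \<in> {0..T}" for s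
    using assms(1) that by (simp add: C_holder_def)
  have "((\<lambda>s. holder_norm k \<alpha> \<Omega> (\<lambda>x. f s x - f t x)) \<longlongrightarrow> 0) (at t within {0..T})"
    using assms(1,3) by (simp add: C_holder_def)
  then have "\<forall>\<^sub>F s in at t within {0..T}. holder_norm k \<alpha> \<Omega> (\<lambda>x. f s x - f t x) < ennreal \<epsilon>"
    using \<open>0 < \<epsilon>\<close> by (intro order_tendstoD(2)) auto
  moreover have "\<forall>\<^sub>F s in at t within {0..T}. s \<in> {0..T}"
    by (simp add: eventually_at_filter)
  ultimately show ?thesis
  proof eventually_elim
    case (elim s)
    show ?case
    proof (intro ballI)
      fix bs :: "'a list" and x assume bs: "bs \<in> indices_upto k" and x: "x \<in> \<Omega>"
      have "ennreal \<bar>partials bs (\<lambda>x. f s x - f t x) x\<bar> \<le> ennreal \<epsilon>"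
        using holder_norm_ge_partials[OF bs x] elim(1) by (metis order.strict_implies_order order_trans)
      moreover have "partials bs (\<lambda>x. f s x - f t x) x = partials bs (f s) x - partials bs (f t) x"
        using bs x elim(2) assms(2,3) C by (intro partials_diff[of _ k] holder_space_Ck_on) auto
      ultimately show "\<bar>partials bs (f s) x - partials bs (f t) x\<bar> \<le> \<epsilon>"
        using \<open>0 < \<epsilon>\<close> by simp
    qed
  qed
qed

text \<open>Closeness within 1 to the derivatives at time \<open>t\<close> adds 1 to their bound.
  The result is a bound valid at every time near \<open>t\<close>.\<close>

lemma C_holder_partials_locally_bounded:
  fixes f :: "real \<Rightarrow> 'a::euclidean_space \<Rightarrow> real"
  assumes "C_holder T k \<alpha> \<Omega> f" "open \<Omega>" "t \<in> {0..T}"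
  obtains u N where "0 < u" "0 \<le> N"
    and "\<And>s bs x. s \<in> cball t u \<inter> {0..T} \<Longrightarrow> bs \<in> indices_upto k \<Longrightarrow> x \<in> \<Omega> \<Longrightarrow> \<bar>partials bs (f s) x\<bar> \<le> N"
proof -
  have "f t \<in> holder_space k \<alpha> \<Omega>" using assms by (simp add: C_holder_def)
  then obtain N where N: "0 \<le> N" "\<And>bs x. bs \<in> indices_upto k \<Longrightarrow> x \<in> \<Omega> \<Longrightarrow> \<bar>partials bs (f t) x\<bar> \<le> N"
    by (rule holder_space_partials_bounded) blast
  obtain d where d: "d > 0" "\<And>s. s \<in> {0..T} \<Longrightarrow> s \<noteq> t \<Longrightarrow> dist s t < d \<Longrightarrow>
      \<forall>bs\<in>indices_upto k. \<forall>x\<in>\<Omega>. \<bar>partials bs (f s) x - partials bs (f t) x\<bar> \<le> 1"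
    using C_holder_partials_eventually_close[OF assms zero_less_one] unfolding eventually_at by blast
  show ?thesis
  proof (rule that[of "d / 2" "N + 1"])
    fix s and bs :: "'a list" and x assume s: "s \<in> cball t (d / 2) \<inter> {0..T}" and bs: "bs \<in> indices_upto k" and x: "x \<in> \<Omega>"
    show "\<bar>partials bs (f s) x\<bar> \<le> N + 1"
    proof (cases "s = t")
      case False
      have "dist s t < d" using s \<open>d > 0\<close> by (simp add: dist_commute)
      then have "\<bar>partials bs (f s) x - partials bs (f t) x\<bar> \<le> 1" using d(2) s bs x False by blast
      then show ?thesis using N(2)[OF bs x] by linarith
    qed (use N(2)[OF bs x] in simp)
  qed (use d N in auto)
qed

lemma holder_space_grad_continuous_on:
  assumes "f \<in> holder_space k \<alpha> \<Omega>" "1 \<le> k"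
  shows "continuous_on (closure \<Omega>) (grad \<Omega> f)"
proof -
  have "continuous_on (closure \<Omega>) (partials_ext \<Omega> [b] f)" if "b \<in> Basis" for b
    using assms that by (simp add: holder_space_def Ck_closure_def indices_upto_def)
  then show ?thesis unfolding grad_def by (intro continuous_intros) simp
qed

text \<open>Bounded second derivatives inside, uniformly for nearby times, give a Lipschitz bound up
  to the boundary through the connecting paths. The notion of local Lipschitz continuity uses a
  single radius for time and space, hence the minimum of \<open>u\<close> and
  \<open>r\<close>.\<close>

lemma C_holder_grad_local_lipschitz:
  fixes \<Omega> :: "'a::euclidean_space set"
  assumes "open \<Omega>" "smooth_boundary \<Omega>" "C_holder T 2 \<alpha> \<Omega> f"
  shows "local_lipschitz {0..T} (closure \<Omega>) (\<lambda>t. grad \<Omega> (f t))"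
proof (rule local_lipschitzI)
  fix t x assume t: "t \<in> {0..T}" and x: "x \<in> closure \<Omega>"
  obtain u N where u: "0 < u" "0 \<le> N"
    and N: "\<And>s bs x. s \<in> cball t u \<inter> {0..T} \<Longrightarrow> bs \<in> indices_upto 2 \<Longrightarrow> x \<in> \<Omega> \<Longrightarrow> \<bar>partials bs (f s) x\<bar> \<le> N"
    by (rule C_holder_partials_locally_bounded[OF assms(3,1) t]) blast
  obtain r where r: "0 < r"
    and lip: "\<And>(F :: 'a \<Rightarrow> 'a) M x' y'. continuous_on (closure \<Omega>) F \<Longrightarrow>
      (\<And>z. z \<in> \<Omega> \<Longrightarrow> \<exists>D. (F has_derivative D) (at z) \<and> (\<forall>h. norm (D h) \<le> M * norm h)) \<Longrightarrow> 0 \<le> M \<Longrightarrow>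
      x' \<in> closure \<Omega> \<inter> cball x r \<Longrightarrow> y' \<in> closure \<Omega> \<inter> cball x r \<Longrightarrow>
      norm (F x' - F y') \<le> 9 * M * norm (x' - y')"
    by (rule smooth_boundary_local_lipschitz[OF assms(1,2) x]) blast
  let ?M = "(real DIM('a))\<^sup>2 * N"
  have "(9 * ?M)-lipschitz_on (cball x (min u r) \<inter> closure \<Omega>) (grad \<Omega> (f s))"
    if s: "s \<in> cball t (min u r) \<inter> {0..T}" for s
  proof (rule lipschitz_onI)
    have h: "f s \<in> holder_space 2 \<alpha> \<Omega>" using assms(3) s by (simp add: C_holder_def)
    fix x' y' assume xy: "x' \<in> cball x (min u r) \<inter> closure \<Omega>" "y' \<in> cball x (min u r) \<inter> closure \<Omega>"
    have "norm (grad \<Omega> (f s) x' - grad \<Omega> (f s) y') \<le> 9 * ?M * norm (x' - y')"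
    proof (rule lip)
      show "continuous_on (closure \<Omega>) (grad \<Omega> (f s))"
        by (rule holder_space_grad_continuous_on[OF h]) simp
      fix z assume z: "z \<in> \<Omega>"
      obtain D where "(grad \<Omega> (f s) has_derivative D) (at z)" "\<And>h. norm (D h) \<le> ?M * norm h"
        by (rule grad_derivative_bound[OF holder_space_Ck_on[OF h] assms(1) z, of N]) (use N s z in auto)
      then show "\<exists>D. (grad \<Omega> (f s) has_derivative D) (at z) \<and> (\<forall>h. norm (D h) \<le> ?M * norm h)"
        by blast
    qed (use u xy in auto)
    then show "dist (grad \<Omega> (f s) x') (grad \<Omega> (f s) y') \<le> 9 * ?M * dist x' y'"
      by (simp add: dist_norm)
  qed (use u in simp)
  then have "\<exists>L. \<forall>s\<in>cball t (min u r) \<inter> {0..T}.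
      L-lipschitz_on (cball x (min u r) \<inter> closure \<Omega>) (grad \<Omega> (f s))" by blast
  moreover have "0 < min u r" using u(1) r by simp
  ultimately show "\<exists>u>0. \<exists>L. \<forall>s\<in>cball t u \<inter> {0..T}.
      L-lipschitz_on (cball x u \<inter> closure \<Omega>) (grad \<Omega> (f s))" by blast
qed

text \<open>The norm sees interior points only; the estimate reaches the boundary because the
  gradients are continuous on the closure.\<close>

lemma C_holder_grad_continuous_in_time:
  fixes \<Omega> :: "'a::euclidean_space set"
  assumes "open \<Omega>" "C_holder T 2 \<alpha> \<Omega> f" "x \<in> closure \<Omega>"
  shows "continuous_on {0..T} (\<lambda>t. grad \<Omega> (f t) x)"
  unfolding continuous_on_def
proof (intro ballI tendstoI)
  fix t \<epsilon> :: real assume t: "t \<in> {0..T}" and \<epsilon>: "0 < \<epsilon>"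
  \<comment> \<open>Each of the \<open>DIM('a)\<close> components contributes at most \<delta>, and
    the factor 2 keeps the sum strictly below \<epsilon>.\<close>
  define \<delta> where "\<delta> = \<epsilon> / (2 * real DIM('a))"
  have \<delta>: "\<delta> > 0" "real DIM('a) * \<delta> < \<epsilon>" using \<epsilon> by (simp_all add: \<delta>_def)
  have h: "f s \<in> holder_space 2 \<alpha> \<Omega>" if "s \<in> {0..T}" for s
    using assms(2) that by (simp add: C_holder_def)
  have "\<forall>\<^sub>F s in at t within {0..T}. s \<in> {0..T}"
    by (simp add: eventually_at_filter)
  with C_holder_partials_eventually_close[OF assms(2,1) t \<delta>(1)]
  show "\<forall>\<^sub>F s in at t within {0..T}. dist (grad \<Omega> (f s) x) (grad \<Omega> (f t) x) < \<epsilon>"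
  proof eventually_elim
    case (elim s)
    have "norm (grad \<Omega> (f s) z - grad \<Omega> (f t) z) \<le> real DIM('a) * \<delta>" if z: "z \<in> \<Omega>" for z
    proof -
      have "\<bar>partials [b] (f s) z - partials [b] (f t) z\<bar> \<le> \<delta>" if "b \<in> Basis" for b
        using elim(1) that z by (simp add: indices_upto_def del: partials.simps)
      then have "norm (\<Sum>b\<in>Basis. (partials [b] (f s) z - partials [b] (f t) z) *\<^sub>R b) \<le> (\<Sum>b\<in>(Basis::'a set). \<delta>)"
        by (intro sum_norm_le) (simp del: partials.simps)
      then show ?thesis
        by (simp add: grad_eq_frechet_derivative[OF z] sum_subtractf scaleR_diff_left)
    qed
    then have "norm (grad \<Omega> (f s) x - grad \<Omega> (f t) x) \<le> real DIM('a) * \<delta>"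
      using t elim(2) by (intro continuous_on_closure_norm_le[OF _ _ assms(3)] continuous_intros
          holder_space_grad_continuous_on[OF h]) auto
    then show ?case using \<delta>(2) by (simp add: dist_norm)
  qed
qed

subsection \<open>Tangential flows\<close>

text \<open>The tangency condition makes the derivative of the defining function along the field vanish on
  the boundary; since a point at level \<open>g x\<close> is within a multiple of \<open>\<bar>g x\<bar>\<close> of the boundary,
  Lipschitz continuity bounds this derivative by a multiple of \<open>\<bar>g x\<bar>\<close>.\<close>

lemma local_defining_function_tangential_bound:
  fixes p :: "'a::euclidean_space"
  assumes "open \<Omega>" "p \<in> frontier \<Omega>" and L: "local_defining_function \<Omega> p U g"
  obtains r C where "0 < r" "0 \<le> C" "ball p r \<subseteq> U"
    and "\<And>w K B x. K-lipschitz_on (closure \<Omega>) w \<Longrightarrow> (\<And>z. z \<in> closure \<Omega> \<Longrightarrow> norm (w z) \<le> B) \<Longrightarrow>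
      (\<And>z n. outward_unit_normal \<Omega> z n \<Longrightarrow> w z \<bullet> n = 0) \<Longrightarrow> x \<in> closure \<Omega> \<inter> ball p r \<Longrightarrow>
      \<bar>grad U g x \<bullet> w x\<bar> \<le> C * (K + B) * \<bar>g x\<bar>"
proof -
  let ?G = "grad U g" and ?d = "real DIM('a)"
  have U: "open U" "p \<in> U" and C2: "Ck_on 2 U g" and G0: "\<And>x. x \<in> U \<Longrightarrow> ?G x \<noteq> 0"
    and \<Omega>U: "\<Omega> \<inter> U = {x \<in> U. g x < 0}"
    using L by (auto simp: local_defining_function_def smooth_on_def)
  obtain r0 c e where r0: "0 < r0" "0 < c" "norm e = 1" "ball p r0 \<subseteq> U"
    and cone: "\<And>a b s. a \<in> ball p r0 \<Longrightarrow> b \<in> ball p r0 \<Longrightarrow> norm (b - a - s *\<^sub>R e) \<le> s / 4 \<Longrightarrow> c * s \<le> g b - g a"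
    by (rule local_defining_function_cone[OF L]) blast
  define r1 where "r1 = r0 / 2"
  have r1: "0 < r1" "cball p r1 \<subseteq> ball p r0" "cball p r1 \<subseteq> U" using r0 by (auto simp: r1_def)
  have "\<exists>N. \<forall>x\<in>cball p r1. \<bar>partials bs g x\<bar> \<le> N" if bs: "bs \<in> indices_upto 2" for bs
  proof -
    have "continuous_on (cball p r1) (partials bs g)"
      using C2 bs r1 by (auto simp: Ck_on_def intro: continuous_on_subset)
    then have "bounded (partials bs g ` cball p r1)"
      by (intro compact_imp_bounded compact_continuous_image) auto
    then show ?thesis by (auto simp: bounded_iff)
  qed
  then obtain N' where N': "\<And>bs x. bs \<in> indices_upto 2 \<Longrightarrow> x \<in> cball p r1 \<Longrightarrow> \<bar>partials bs g x\<bar> \<le> N' bs"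
    by metis
  \<comment> \<open>There are finitely many multi-indices, so a sum of bounds dominates all of them
    at once.\<close>
  define N where "N = (\<Sum>bs\<in>(indices_upto 2 :: 'a list set). \<bar>N' bs\<bar>)"
  have N: "\<bar>partials bs g x\<bar> \<le> N" if "bs \<in> indices_upto 2" "x \<in> cball p r1" for bs x
  proof -
    have "\<bar>N' bs\<bar> \<le> N"
      unfolding N_def using that finite_indices_upto by (intro member_le_sum) auto
    then show ?thesis using N'[OF that] by linarith
  qed
  have N0: "0 \<le> N" by (simp add: N_def sum_nonneg)
  have Glip: "norm (?G x - ?G z) \<le> ?d\<^sup>2 * N * norm (x - z)"
    if xz: "x \<in> cball p r1" "z \<in> cball p r1" for x z
  proof -
    have "\<exists>D. (?G has_derivative D) (at y) \<and> (\<forall>h. norm (D h) \<le> ?d\<^sup>2 * N * norm h)"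
      if y: "y \<in> cball p r1" for y
    proof -
      obtain D where "(?G has_derivative D) (at y)" "\<And>h. norm (D h) \<le> ?d\<^sup>2 * N * norm h"
        by (rule grad_derivative_bound[OF C2 U(1), of y N]) (use y r1 N in auto)
      then show ?thesis by blast
    qed
    then obtain D where D: "\<And>y. y \<in> cball p r1 \<Longrightarrow> (?G has_derivative D y) (at y)"
      "\<And>y h. y \<in> cball p r1 \<Longrightarrow> norm (D y h) \<le> ?d\<^sup>2 * N * norm h" by metis
    have seg: "closed_segment x z \<subseteq> cball p r1" using xz by (intro closed_segment_subset) auto
    show ?thesis
    proof (rule open_segment_derivative_bound[of x z _ D])
      show "continuous_on (closed_segment x z) ?G"
        using C2 seg r1 by (intro continuous_on_subset[OF Ck_on_grad(1)[OF C2]]) auto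
    qed (use D seg in \<open>auto simp: open_segment_def\<close>)
  qed
  have contg: "continuous_on U g"
    by (rule has_derivative_continuous_on[OF has_derivative_at_withinI[OF Ck_on_grad(2)[OF C2]]]) simp_all
  have neg: "g z < 0" if "z \<in> \<Omega>" "z \<in> U" for z using \<Omega>U that by blast
  have clg: "g x \<le> 0" if "x \<in> closure \<Omega>" "x \<in> U" for x
    using local_defining_function_nonpos_on_closure[OF L that] .
  have frg: "g z = 0" if "z \<in> frontier \<Omega>" "z \<in> U" for z
  proof -
    have "z \<in> closure \<Omega>" "z \<notin> \<Omega>" using that assms(1) by (auto simp: frontier_def interior_open)
    then have "\<not> g z < 0" using \<Omega>U that(2) by blast
    then show ?thesis using clg[OF \<open>z \<in> closure \<Omega>\<close> that(2)] by simp
  qed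
  \<comment> \<open>Since \<open>g\<close> vanishes at \<open>p\<close>, a small neighbourhood makes
    \<open>\<bar>g x\<bar> / c\<close> less than \<open>r1 / 2\<close>. With \<open>x\<close> within
    \<open>r1 / 2\<close> of \<open>p\<close>, the shifted point \<open>y\<close> below stays in
    \<open>cball p r1\<close>.\<close>
  have "continuous (at p) g" using contg U by (simp add: continuous_on_eq_continuous_at)
  moreover have "0 < c * r1 / 2" using r0 r1 by simp
  ultimately obtain r2 where r2: "r2 > 0" "\<And>x. dist x p < r2 \<Longrightarrow> dist (g x) (g p) < c * r1 / 2"
    unfolding continuous_at_eps_delta by blast
  define r where "r = min r2 (r1 / 2)"
  \<comment> \<open>The first summand bounds the gradient of \<open>g\<close> and meets the
    Lipschitz constant \<open>K\<close> of the field; the second is a Lipschitz constant of that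
    gradient and meets the bound \<open>B\<close>. Division by \<open>c\<close> converts
    \<open>\<bar>g x\<bar>\<close> into a distance.\<close>
  define C where "C = (?d * N + ?d\<^sup>2 * N) / c"
  have C0: "0 \<le> C" using N0 r0 by (simp add: C_def)
  have rU: "ball p r \<subseteq> U" using r1 by (auto simp: r_def)
  have key: "\<bar>?G x \<bullet> w x\<bar> \<le> C * (K + B) * \<bar>g x\<bar>"
    if lip: "K-lipschitz_on (closure \<Omega>) w" and B: "\<And>z. z \<in> closure \<Omega> \<Longrightarrow> norm (w z) \<le> B"
      and tan: "\<And>z n. outward_unit_normal \<Omega> z n \<Longrightarrow> w z \<bullet> n = 0"
      and x: "x \<in> closure \<Omega> \<inter> ball p r" for w K B x
  proof -
    \<comment> \<open>By the cone estimate, moving this far along \<open>e\<close> brings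
      \<open>g\<close> from \<open>g x\<close> up to at least 0, so the segment from
      \<open>x\<close> to \<open>y\<close> meets the frontier.\<close>
    define s where "s = \<bar>g x\<bar> / c"
    have xp: "dist x p < r" using x by (simp add: dist_commute)
    have xU: "x \<in> U" using x rU by auto
    have gx: "g x = - (c * s)" using clg[of x] x xU r0 by (simp add: s_def)
    have "\<bar>g x\<bar> < c * r1 / 2"
      using r2(2)[of x] xp frg[OF assms(2) U(2)] by (simp add: r_def dist_real_def)
    then have s: "0 \<le> s" "s < r1 / 2" using r0 by (simp_all add: s_def field_simps)
    have x1: "x \<in> cball p r1" using xp r1 by (simp add: r_def dist_commute)
    define y where "y = x + s *\<^sub>R e"
    have "dist p y \<le> dist p x + norm (s *\<^sub>R e)"
      by (rule order_trans[OF dist_triangle[of _ _ x]]) (simp add: y_def dist_norm)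
    then have y1: "y \<in> cball p r1" using s xp r0 by (simp add: r_def dist_commute)
    have "c * s \<le> g y - g x"
      using x1 y1 r1 s by (intro cone) (auto simp: y_def)
    then have "0 \<le> g y" using gx by simp
    then have y\<Omega>: "y \<notin> \<Omega>" using neg[of y] y1 r1(3) by (meson in_mono not_le)
    have "\<exists>z\<in>frontier \<Omega>. z \<in> closed_segment x y"
    proof (cases "x \<in> \<Omega>")
      case True
      then have "closed_segment x y \<inter> frontier \<Omega> \<noteq> {}"
        using y\<Omega> by (intro connected_Int_frontier) auto
      then show ?thesis by blast
    next
      case False
      then have "x \<in> frontier \<Omega>" using x assms(1) by (simp add: frontier_def interior_open)
      then show ?thesis by auto
    qed
    then obtain z where z: "z \<in> frontier \<Omega>" "z \<in> closed_segment x y" by blast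
    have "norm (x - z) \<le> norm (x - y)"
      using segment_bound1[OF z(2)] by (simp add: norm_minus_commute)
    then have xz: "norm (x - z) \<le> s" using s r0 by (simp add: y_def)
    have z1: "z \<in> cball p r1"
      using z(2) closed_segment_subset[OF x1 y1 convex_cball] by blast
    have zcl: "z \<in> closure \<Omega>" using z(1) by (simp add: frontier_def)
    have zU: "z \<in> U" using z1 r1 by auto
    \<comment> \<open>The same \<open>g\<close> defines the boundary near \<open>z\<close>, so its
      normalised gradient there is an outward normal.\<close>
    have "local_defining_function \<Omega> z U g" using L zU by (simp add: local_defining_function_def)
    then have "outward_unit_normal \<Omega> z (?G z /\<^sub>R norm (?G z))"
      using z(1) by (auto simp: outward_unit_normal_def)
    then have "w z \<bullet> (?G z /\<^sub>R norm (?G z)) = 0" by (rule tan)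
    then have Gz: "?G z \<bullet> w z = 0" using G0[OF zU] by (simp add: inner_commute)
    have "norm (w x - w z) \<le> K * norm (x - z)"
      using lipschitz_on_normD[OF lip] x zcl by blast
    also have "\<dots> \<le> K * s" using xz lipschitz_on_nonneg[OF lip] by (rule mult_left_mono)
    finally have w: "norm (w x - w z) \<le> K * s" .
    have G: "norm (?G x - ?G z) \<le> ?d\<^sup>2 * N * s"
      by (rule order_trans[OF Glip[OF x1 z1] mult_left_mono[OF xz]]) (use N0 in simp)
    have Gx: "norm (?G x) \<le> ?d * N" using xU N x1 by (intro grad_norm_bound) auto
    have B0: "0 \<le> B" using B[OF zcl] norm_ge_zero[of "w z"] by linarith
    have K0: "0 \<le> K" using lipschitz_on_nonneg[OF lip] .
    \<comment> \<open>The term \<open>?G z \<bullet> w z\<close> vanishes by tangency; what remains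
      are two increments over a distance of at most \<open>s\<close>.\<close>
    have "?G x \<bullet> w x = ?G x \<bullet> (w x - w z) + (?G x - ?G z) \<bullet> w z"
      using Gz by (simp add: inner_diff_left inner_diff_right)
    also have "\<bar>\<dots>\<bar> \<le> norm (?G x) * norm (w x - w z) + norm (?G x - ?G z) * norm (w z)"
      by (intro order_trans[OF abs_triangle_ineq] add_mono Cauchy_Schwarz_ineq2)
    also have "\<dots> \<le> (?d * N) * (K * s) + (?d\<^sup>2 * N * s) * B"
      using Gx w G B[OF zcl] N0 s by (intro add_mono mult_mono) auto
    also have "\<dots> \<le> (?d * N) * ((K + B) * s) + (?d\<^sup>2 * N * s) * (K + B)"
      using N0 s B0 K0 by (intro add_mono mult_left_mono mult_right_mono) auto
    also have "\<dots> = C * (K + B) * \<bar>g x\<bar>"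
      using r0 by (simp add: C_def s_def field_simps)
    finally show ?thesis .
  qed
  show ?thesis
    by (rule that[of r C]) (use r2 r1 C0 rU key in \<open>auto simp: r_def\<close>)
qed

text \<open>Let \<open>a\<close> be the last time up to \<open>t\<close> at which the trajectory is
  on the frontier. Shortly after \<open>a\<close>, the derivative of \<open>g\<close> along the
  trajectory is bounded by a multiple of \<open>\<bar>g\<bar>\<close>, and \<open>g\<close> vanishes
  at time \<open>a\<close>. Gronwall keeps it zero, so the trajectory is on the frontier at a later
  time.\<close>

lemma tangential_flow_preserves_frontier:
  fixes v :: "real \<Rightarrow> 'a::euclidean_space \<Rightarrow> 'a"
  assumes "open \<Omega>" "smooth_boundary \<Omega>"
    and lip: "\<And>t. t \<in> {0..T} \<Longrightarrow> K-lipschitz_on (closure \<Omega>) (v t)"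
    and bound: "\<And>t z. t \<in> {0..T} \<Longrightarrow> z \<in> closure \<Omega> \<Longrightarrow> norm (v t z) \<le> B"
    and tangential: "\<And>t z n. t \<in> {0..T} \<Longrightarrow> outward_unit_normal \<Omega> z n \<Longrightarrow> v t z \<bullet> n = 0"
    and closure: "\<And>t. t \<in> {0..T} \<Longrightarrow> y t \<in> closure \<Omega>"
    and ode: "\<And>t. t \<in> {0..T} \<Longrightarrow> (y has_vector_derivative v t (y t)) (at t within {0..})"
    and "y 0 \<in> frontier \<Omega>" "t \<in> {0..T}"
  shows "y t \<in> frontier \<Omega>"
proof (rule ccontr)
  assume nt: "y t \<notin> frontier \<Omega>"
  have conty: "continuous_on {0..t} y"
    unfolding continuous_on_eq_continuous_within
  proof
    fix s assume "s \<in> {0..t}"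
    then have "continuous (at s within {0..}) y"
      using ode[of s] \<open>t \<in> {0..T}\<close> has_vector_derivative_continuous by auto
    then show "continuous (at s within {0..t}) y" by (rule continuous_within_subset) auto
  qed
  have "closed ({0..t} \<inter> y -` frontier \<Omega>)"
    by (rule continuous_closed_preimage[OF conty]) auto
  moreover have "bounded ({0..t} \<inter> y -` frontier \<Omega>)"
    by (rule bounded_subset[OF bounded_closed_interval]) auto
  ultimately have "compact ({0..t} \<inter> y -` frontier \<Omega>)" by (simp add: compact_eq_bounded_closed)
  moreover have "0 \<in> {0..t} \<inter> y -` frontier \<Omega>" using assms by simp
  ultimately obtain a where a: "a \<in> {0..t} \<inter> y -` frontier \<Omega>"
    and amax: "\<And>s. s \<in> {0..t} \<inter> y -` frontier \<Omega> \<Longrightarrow> s \<le> a"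
    using compact_attains_sup[of "{0..t} \<inter> y -` frontier \<Omega>"] by blast
  have at: "0 \<le> a" "a < t" "y a \<in> frontier \<Omega>"
    using a nt by (auto simp: order.strict_iff_order)
  obtain U g where L: "local_defining_function \<Omega> (y a) U g"
    using assms(2) at(3) by (auto simp: smooth_boundary_def)
  then have U: "open U" and C1: "Ck_on 1 U g" and \<Omega>U: "\<Omega> \<inter> U = {x \<in> U. g x < 0}"
    by (auto simp: local_defining_function_def smooth_on_def)
  obtain r C where r: "0 < r" "0 \<le> C" "ball (y a) r \<subseteq> U"
    and est: "\<And>w K B x. K-lipschitz_on (closure \<Omega>) w \<Longrightarrow> (\<And>z. z \<in> closure \<Omega> \<Longrightarrow> norm (w z) \<le> B) \<Longrightarrow>
      (\<And>z n. outward_unit_normal \<Omega> z n \<Longrightarrow> w z \<bullet> n = 0) \<Longrightarrow> x \<in> closure \<Omega> \<inter> ball (y a) r \<Longrightarrow>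
      \<bar>grad U g x \<bullet> w x\<bar> \<le> C * (K + B) * \<bar>g x\<bar>"
    by (rule local_defining_function_tangential_bound[OF assms(1) at(3) L]) blast
  have "continuous (at a within {0..t}) y"
    using conty at by (simp add: continuous_on_eq_continuous_within)
  then obtain d where d: "d > 0" "\<And>s. s \<in> {0..t} \<Longrightarrow> dist s a < d \<Longrightarrow> dist (y s) (y a) < r"
    using r(1) unfolding continuous_within_eps_delta by blast
  define b where "b = min t (a + d / 2)"
  have b: "a < b" "b \<le> t" using at d by (auto simp: b_def)
  have near: "y s \<in> closure \<Omega> \<inter> ball (y a) r" if "s \<in> {a..b}" for s
  proof -
    have "s \<in> {0..t}" "dist s a < d" using that at d b by (auto simp: b_def dist_real_def)
    then show ?thesis using d(2)[of s] closure[of s] \<open>t \<in> {0..T}\<close> by (simp add: dist_commute)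
  qed
  have neg: "g z < 0" if "z \<in> \<Omega>" "z \<in> U" for z using \<Omega>U that by blast
  have pos: "z \<in> \<Omega>" if "g z < 0" "z \<in> U" for z using \<Omega>U that by blast
  have "norm (g (y b)) \<le> exp (C * (K + B) * (b - a)) * norm (g (y a))"
  proof (rule gronwall_norm_le)
    have g: "continuous_on U g"
      by (rule has_derivative_continuous_on[OF has_derivative_at_withinI[OF Ck_on_grad(2)[OF C1]]]) simp_all
    have ab: "{a..b} \<subseteq> {0..t}" using at(1) b by simp
    have "y ` {a..b} \<subseteq> U" using near r(3) by blast
    then show "continuous_on {a..b} (\<lambda>s. g (y s))"
      by (rule continuous_on_compose2[OF g continuous_on_subset[OF conty ab]])
  next
    fix s assume s: "a < s" "s < b"
    then have sT: "s \<in> {0..T}" using at(1) b(2) \<open>t \<in> {0..T}\<close> by simp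
    have yU: "y s \<in> U" using near[of s] s r(3) by (simp add: subset_eq)
    \<comment> \<open>At a positive time the one-sided derivative is two-sided.\<close>
    have "at s within {0..} = at s" using s at(1) by (intro at_within_interior) simp
    then have "(y has_derivative (\<lambda>h. h *\<^sub>R v s (y s))) (at s)"
      using ode[OF sT] by (simp add: has_vector_derivative_def)
    from diff_chain_at[OF this Ck_on_grad(2)[OF C1 _ yU]]
    show "((\<lambda>s. g (y s)) has_vector_derivative grad U g (y s) \<bullet> v s (y s)) (at s)"
      by (simp add: has_vector_derivative_def o_def)
    show "norm (grad U g (y s) \<bullet> v s (y s)) \<le> C * (K + B) * norm (g (y s))"
      unfolding real_norm_def
      by (rule est[OF lip[OF sT] bound[OF sT] tangential[OF sT]]) (use near[of s] s in auto)
  qed (use b in simp)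
  moreover have "g (y a) = 0"
  proof -
    have ya: "y a \<in> closure \<Omega>" "y a \<notin> \<Omega>" "y a \<in> U"
      using at(3) assms(1) r by (auto simp: frontier_def interior_open)
    have "g (y a) \<le> 0" by (rule local_defining_function_nonpos_on_closure[OF L ya(1,3)])
    moreover have "\<not> g (y a) < 0" using pos ya by blast
    ultimately show ?thesis by simp
  qed
  ultimately have "g (y b) = 0" by simp
  then have "y b \<notin> \<Omega>" using neg[of "y b"] near[of b] b r(3) by auto
  then have "y b \<in> frontier \<Omega>" using near[of b] b assms(1) by (simp add: frontier_def interior_open)
  then show False using amax[of b] b at by auto
qed

text \<open>Compactness makes the Lipschitz constant and the bound of the field uniform. Gronwall
  for differences of trajectories then gives a jointly continuous flow, and the homotopy lemma
  applies because the frontier is preserved.\<close>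

lemma tangential_flow_surjective:
  fixes v :: "real \<Rightarrow> 'a::euclidean_space \<Rightarrow> 'a"
  assumes "open \<Omega>" "bounded \<Omega>" "smooth_boundary \<Omega>" "0 \<le> T"
    and loclip: "local_lipschitz {0..T} (closure \<Omega>) v"
    and contv: "\<And>x. x \<in> closure \<Omega> \<Longrightarrow> continuous_on {0..T} (\<lambda>t. v t x)"
    and tangential: "\<And>t z n. t \<in> {0..T} \<Longrightarrow> outward_unit_normal \<Omega> z n \<Longrightarrow> v t z \<bullet> n = 0"
    and closure: "\<And>t x. t \<in> {0..T} \<Longrightarrow> x \<in> closure \<Omega> \<Longrightarrow> X t x \<in> closure \<Omega>"
    and ode: "\<And>t x. t \<in> {0..T} \<Longrightarrow> x \<in> closure \<Omega> \<Longrightarrow>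
      ((\<lambda>s. X s x) has_vector_derivative v t (X t x)) (at t within {0..})"
    and X0: "\<And>x. x \<in> closure \<Omega> \<Longrightarrow> X 0 x = x"
  shows "X T ` closure \<Omega> = closure \<Omega>"
proof -
  have cpt: "compact (closure \<Omega>)" using assms(2) by (simp add: compact_closure)
  obtain K where K: "\<And>t. t \<in> {0..T} \<Longrightarrow> K-lipschitz_on (closure \<Omega>) (v t)"
    using local_lipschitz_compact_implies_lipschitz[OF loclip cpt compact_Icc contv] by blast
  have "continuous_on ({0..T} \<times> closure \<Omega>) (\<lambda>(t, x). v t x)"
    using loclip contv by (rule continuous_on_TimesI)
  then have "bounded ((\<lambda>(t, x). v t x) ` ({0..T} \<times> closure \<Omega>))"
    using cpt by (intro compact_imp_bounded compact_continuous_image compact_Times) auto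
  then obtain B where B: "\<And>t z. t \<in> {0..T} \<Longrightarrow> z \<in> closure \<Omega> \<Longrightarrow> norm (v t z) \<le> B"
    unfolding bounded_iff by force
  have K0: "0 \<le> K" using K[of 0] \<open>0 \<le> T\<close> lipschitz_on_nonneg by fastforce
  have contX: "continuous_on {0..T} (\<lambda>t. X t x)" if x: "x \<in> closure \<Omega>" for x
    unfolding continuous_on_eq_continuous_within
  proof
    fix s assume s: "s \<in> {0..T}"
    show "continuous (at s within {0..T}) (\<lambda>t. X t x)"
      by (rule continuous_within_subset[OF has_vector_derivative_continuous[OF ode[OF s x]]]) auto
  qed
  have lipX: "(exp (K * T))-lipschitz_on (closure \<Omega>) (X t)" if t: "t \<in> {0..T}" for t
  proof (rule lipschitz_onI)
    fix x y assume xy: "x \<in> closure \<Omega>" "y \<in> closure \<Omega>"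
    have "norm (X t x - X t y) \<le> exp (K * (t - 0)) * norm (X 0 x - X 0 y)"
    proof (rule gronwall_norm_le)
      show "continuous_on {0..t} (\<lambda>t. X t x - X t y)"
        using t xy by (intro continuous_intros continuous_on_subset[OF contX]) auto
      fix s assume s: "0 < s" "s < t"
      then have sT: "s \<in> {0..T}" using t by auto
      have "at s within {0..} = at s" using s by (intro at_within_interior) simp
      then show "((\<lambda>t. X t x - X t y) has_vector_derivative v s (X s x) - v s (X s y)) (at s)"
        using ode[OF sT xy(1)] ode[OF sT xy(2)] by (intro has_vector_derivative_diff) simp_all
      show "norm (v s (X s x) - v s (X s y)) \<le> K * norm (X s x - X s y)"
        using closure sT xy by (intro lipschitz_on_normD[OF K]) auto
    qed (use t in simp)
    also have "\<dots> \<le> exp (K * T) * norm (x - y)"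
      using t K0 X0 xy by (simp add: mult_right_mono mult_left_mono)
    finally show "dist (X t x) (X t y) \<le> exp (K * T) * dist x y" by (simp add: dist_norm)
  qed simp
  have "local_lipschitz {0..T} (closure \<Omega>) X"
  proof (rule local_lipschitzI)
    fix t x show "\<exists>u>0. \<exists>L. \<forall>t\<in>cball t u \<inter> {0..T}. L-lipschitz_on (cball x u \<inter> closure \<Omega>) (X t)"
      using lipschitz_on_subset[OF lipX] by (intro exI[of _ 1]) (auto intro!: exI[of _ "exp (K * T)"])
  qed
  then have cont: "continuous_on ({0..T} \<times> closure \<Omega>) (\<lambda>(t, x). X t x)"
    using contX by (rule continuous_on_TimesI)
  have "\<Omega> \<subseteq> X T ` closure \<Omega>"
  proof (rule homotopy_preserving_frontier_image_superset[OF assms(1,2,4) cont X0])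
    fix t x assume t: "t \<in> {0..T}" and x: "x \<in> frontier \<Omega>"
    then have xc: "x \<in> closure \<Omega>" by (simp add: frontier_def)
    show "X t x \<in> frontier \<Omega>"
      by (rule tangential_flow_preserves_frontier[OF assms(1,3) K B tangential, where y = "\<lambda>t. X t x"])
        (use closure ode xc X0 x t in auto)
  qed
  \<comment> \<open>The homotopy lemma covers the open set only; the image is compact, hence closed,
    and therefore contains the closure as well.\<close>
  moreover have "continuous_on (closure \<Omega>) (X T)"
    using lipX[of T] \<open>0 \<le> T\<close> by (intro lipschitz_on_continuous_on) simp
  then have "closed (X T ` closure \<Omega>)"
    using cpt by (intro compact_imp_closed compact_continuous_image)
  ultimately have "closure \<Omega> \<subseteq> X T ` closure \<Omega>" by (rule closure_minimal)
  moreover have "X T ` closure \<Omega> \<subseteq> closure \<Omega>" using closure \<open>0 \<le> T\<close> by auto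
  ultimately show ?thesis by blast
qed

section \<open>Decay of differences along trajectories and the oscillation identity\<close>

text \<open>The integrating factor \<open>exp s\<close> makes \<open>exp s * D s\<close> constant on
  the half-line.\<close>

lemma exponential_decay:
  fixes D :: "real \<Rightarrow> real"
  assumes "\<And>s. 0 \<le> s \<Longrightarrow> (D has_real_derivative - D s) (at s within {0..})" "0 \<le> t"
  shows "D t = exp (- t) * D 0"
proof -
  have "((\<lambda>s. exp s * D s) has_real_derivative 0) (at s within {0..})" if "s \<in> {0..}" for s
    using that by (auto intro!: derivative_eq_intros assms(1))
  then obtain c where "\<And>s. s \<in> {0..} \<Longrightarrow> exp s * D s = c"
    using has_field_derivative_zero_constant[of "{0..}" "\<lambda>s. exp s * D s"] by auto
  from this[of t] this[of 0] have "exp t * D t = D 0" using assms(2) by simp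
  then show ?thesis by (simp add: exp_minus field_simps)
qed

theorem theorem4p1:
  fixes \<Omega> :: "(real ^ 'd) set"
    and \<rho> \<omega>\<^sub>0 :: "real ^ 'd \<Rightarrow> real"
    and \<omega> \<phi> :: "real \<Rightarrow> real ^ 'd \<Rightarrow> real"
    and \<omega>bar :: "real \<Rightarrow> real"
    and X :: "real \<Rightarrow> real ^ 'd \<Rightarrow> real ^ 'd"
    and t :: real
  assumes "bounded_smooth_domain \<Omega>"
    and "smooth_closure \<Omega> \<rho>"
    and "\<forall>x\<in>closure \<Omega>. \<rho> x > 0"
    and "\<omega>\<^sub>0 \<in> holder_space 0 1 \<Omega>"
    and "global_WLF_solution \<Omega> \<rho> \<omega>\<^sub>0 \<omega> \<phi> \<omega>bar X"
    and "t \<ge> 0"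
  shows "osc (closure \<Omega>) (\<omega> t) = exp (- t) * osc (closure \<Omega>) \<omega>\<^sub>0"
proof -
  have \<Omega>: "open \<Omega>" "bounded \<Omega>" "smooth_boundary \<Omega>" "\<Omega> \<noteq> {}"
    using assms(1) by (simp_all add: bounded_smooth_domain_def)
  have sys: "WLF_system \<Omega> \<rho> \<omega>\<^sub>0 \<omega> \<phi> \<omega>bar X" and reg: "WLF_regularity \<Omega> \<omega> \<phi>"
    using assms(5) by (simp_all add: global_WLF_solution_def)
  have X_cl: "X s x \<in> closure \<Omega>"
    and \<omega>': "((\<lambda>s. \<omega> s (X s x)) has_real_derivative - (\<omega> s (X s x) - \<omega>bar s)) (at s within {0..})"
    and X': "((\<lambda>s. X s x) has_vector_derivative grad \<Omega> (\<phi> s) (X s x)) (at s within {0..})"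
    if "0 \<le> s" "x \<in> closure \<Omega>" for s x
    using sys that unfolding WLF_system_def by blast+
  have X0: "X 0 x = x" and \<omega>0: "\<omega> 0 x = \<omega>\<^sub>0 x" if "x \<in> closure \<Omega>" for x
    using sys that unfolding WLF_system_def by blast+
  have tangential: "grad \<Omega> (\<phi> s) z \<bullet> n = 0" if "0 \<le> s" "outward_unit_normal \<Omega> z n" for s z n
  proof -
    have "z \<in> frontier \<Omega>" using that(2) by (simp add: outward_unit_normal_def)
    then show ?thesis using sys that unfolding WLF_system_def by blast
  qed
  \<comment> \<open>The regularity statement requires a positive final time while \<open>t\<close>
    may be 0, hence \<open>t + 1\<close>; the exponent 1/2 is an arbitrary choice in (0,1).\<close>
  have "C_holder (t + 1) 2 (1 / 2) \<Omega> \<phi>"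
    using reg assms(6) unfolding WLF_regularity_def by simp
  note \<phi> = C_holder_grad_local_lipschitz[OF \<Omega>(1,3) this] C_holder_grad_continuous_in_time[OF \<Omega>(1) this]
  have surj: "X t ` closure \<Omega> = closure \<Omega>"
  proof (rule tangential_flow_surjective[OF \<Omega>(1-3) assms(6)])
    show "local_lipschitz {0..t} (closure \<Omega>) (\<lambda>s. grad \<Omega> (\<phi> s))"
      by (rule local_lipschitz_subset[OF \<phi>(1)]) auto
    show "continuous_on {0..t} (\<lambda>s. grad \<Omega> (\<phi> s) x)" if "x \<in> closure \<Omega>" for x
      by (rule continuous_on_subset[OF \<phi>(2)[OF that]]) auto
  qed (use tangential X_cl X' X0 in auto)
  \<comment> \<open>A reference trajectory: subtracting \<omega> along it removes
    \<open>\<omega>bar\<close>, and its contribution at time \<open>t\<close> is the additive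
    constant of the affine relation.\<close>
  obtain x\<^sub>0 where x0: "x\<^sub>0 \<in> closure \<Omega>" using \<Omega>(4) closure_subset by blast
  show ?thesis
  proof (rule osc_affine_reparametrization[OF _ _ _ surj])
    show "compact (closure \<Omega>)" using \<Omega>(2) by (simp add: compact_closure)
    show "closure \<Omega> \<noteq> {}" using \<Omega>(4) by simp
    show "continuous_on (closure \<Omega>) \<omega>\<^sub>0" by (rule holder_space_continuous_on[OF assms(4)])
    fix x assume x: "x \<in> closure \<Omega>"
    have "((\<lambda>s. \<omega> s (X s x) - \<omega> s (X s x\<^sub>0)) has_real_derivative
        - (\<omega> s (X s x) - \<omega> s (X s x\<^sub>0))) (at s within {0..})" if "0 \<le> s" for s
      by (rule DERIV_cong[OF DERIV_diff[OF \<omega>'[OF that x] \<omega>'[OF that x0]]]) simp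
    from exponential_decay[OF this assms(6)]
    have "\<omega> t (X t x) - \<omega> t (X t x\<^sub>0) = exp (- t) * (\<omega>\<^sub>0 x - \<omega>\<^sub>0 x\<^sub>0)"
      using X0 \<omega>0 x x0 by simp
    then show "\<omega> t (X t x) = exp (- t) * \<omega>\<^sub>0 x + (\<omega> t (X t x\<^sub>0) - exp (- t) * \<omega>\<^sub>0 x\<^sub>0)"
      by (simp add: algebra_simps)
  qed simp
qed

end
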